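(* Let $\mathbf{\Phi}$ be an $m\times N$ frame (for $\mathcal{H}=\mathbb{R}^m$) with frame bounds $0<A\le B<\infty$. Assume that $\mathbf{\Phi}$ satisfies $\mathrm{LRIP}(\kappa N,\delta)$, where $\delta<1$ and $0<\kappa<1$. Then: (i) For every $0<\tau\le 2$, the Bernstein inequality $$\|f_k\|_{\ell^\tau(\mathbf{\Phi})}\le C_\tau(A,\delta,\kappa)\; k^{r}\;\|f_k\|_{\mathcal{H}},\qquad \forall f_k\in\Sigma_k(\mathbf{\Phi}),\ \forall k\ge1,$$ holds with exponent $r=1/\tau-1/2$ and constant $$C_\tau(A,\delta,\kappa)=\max\big\{(1-\delta)^{-1/2},\ A^{-1/2}\kappa^{1/2-1/\tau}\big\}.$$ (ii) For every $0<\tau\le1$ and $0<\theta<1$, with $r=1/\tau-1/2$ and $p$ defined by $\frac1\tau=\frac{\theta}{p}+\frac{1-\theta}{2}$, we have, with equivalent (quasi-)norms, $$\mathcal{A}^r_\tau(\mathbf{\Phi})=\ell^\tau(\mathbf{\Phi})=(\mathcal{H},\ell^p(\mathbf{\Phi}))_{\theta,\tau}.$$ For given $\tau$ and $\theta$, the constants in the norm equivalences may depend on $A,B,\delta,\kappa$, but they do not depend on the dimension $N$.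
   Context: $\mathbf{\Phi}$ is an $m\times N$ matrix with columns $\phi_1,\dots,\phi_N\in\mathcal{H}=\mathbb{R}^m$ (Euclidean norm $\|\cdot\|_{\mathcal{H}}$), so $\mathbf{\Phi}c=\sum_j c_j\phi_j$ for $c\in\mathbb{R}^N$. It is a frame with bounds $A,B$ if $A\|f\|_{\mathcal{H}}^2\le\|\mathbf{\Phi}^Tf\|_2^2\le B\|f\|_{\mathcal{H}}^2$ for all $f\in\mathcal{H}$. Write $\|c\|_0$ for the number of nonzero entries of $c$ and $\|c\|_\tau=(\sum_j|c_j|^\tau)^{1/\tau}$. $\mathrm{LRIP}(k,\delta)$ (for a real number $k>0$): $\|\mathbf{\Phi}c\|_{\mathcal{H}}^2\ge(1-\delta)\|c\|_2^2$ for every $c$ with $\|c\|_0\le k$. $\Sigma_k(\mathbf{\Phi})=\{\mathbf{\Phi}c:\|c\|_0\le k\}$ and $\sigma_k(f,\mathbf{\Phi})=\inf_{y\in\Sigma_k(\mathbf{\Phi})}\|f-y\|_{\mathcal{H}}$. Approximation space $\mathcal{A}^s_q(\mathbf{\Phi})$, $s>0$, $0<q<\infty$: $f\in\mathcal{H}$ with norm $\|f\|_{\mathcal{A}^s_q(\mathbf{\Phi})}=\|f\|_{\mathcal{H}}+|f|_{\mathcal{A}^s_q(\mathbf{\Phi})}<\infty$, where $|f|_{\mathcal{A}^s_q(\mathbf{\Phi})}=\big(\sum_{k\ge1}[k^s\sigma_k(f,\mathbf{\Phi})]^qk^{-1}\big)^{1/q}$. Sparsity space $\ell^\tau(\mathbf{\Phi})$: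 $f\in\mathcal{H}$ with $\|f\|_{\ell^\tau(\mathbf{\Phi})}=\inf\{\|c\|_\tau:\mathbf{\Phi}c=f\}<\infty$. Interpolation space: with $K(f,t)=\inf_{g\in\ell^p(\mathbf{\Phi})}\{\|f-g\|_{\mathcal{H}}+t\|g\|_{\ell^p(\mathbf{\Phi})}\}$, the space $(\mathcal{H},\ell^p(\mathbf{\Phi}))_{\theta,q}$ consists of $f\in\mathcal{H}$ with $\|f\|_{(\mathcal{H},\ell^p(\mathbf{\Phi}))_{\theta,q}}=\big(\int_0^\infty[t^{-\theta}K(f,t)]^q\frac{dt}{t}\big)^{1/q}<\infty$. Since all these spaces coincide as sets in finite dimension, the content lies in the two-sided (quasi-)norm inequalities with the stated control of constants. *)

theory Defs
  imports "HOL-Analysis.Analysis" "Jordan_Normal_Form.Matrix"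
begin

text \<open>
  The frame matrix and the vectors are the dimension-carrying matrices and vectors of
  Jordan_Normal_Form, so that m and N are ordinary natural numbers and the constants of the
  norm equivalences can be chosen before them. For an m by N matrix \<open>\<Phi>\<close> the space H
  is \<open>carrier_vec m\<close> and the coefficient vectors are those of \<open>carrier_vec N\<close>.
  HOL-Analysis has another type constructor \<open>vec\<close>, hence the explicit
  \<open>Matrix.vec\<close>. Quasi-norms that may be infinite take values in \<open>ennreal\<close>.
\<close>

definition enorm2 :: "real Matrix.vec \<Rightarrow> real" where
  "enorm2 v = L2_set (vec_index v) {..<dim_vec v}"

definition lnorm :: "real \<Rightarrow> real Matrix.vec \<Rightarrow> real" where
  "lnorm \<tau> c = (\<Sum>j<dim_vec c. \<bar>vec_index c j\<bar> powr \<tau>) powr (1 / \<tau>)"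

lemma lnorm_2_eq_enorm2: "lnorm 2 c = enorm2 c"
  by (simp add: lnorm_def enorm2_def L2_set_def powr_half_sqrt sum_nonneg)

definition nnz :: "real Matrix.vec \<Rightarrow> nat" where
  "nnz c = card {j. j < dim_vec c \<and> vec_index c j \<noteq> 0}"

definition frame_bounds :: "real mat \<Rightarrow> real \<Rightarrow> real \<Rightarrow> bool" where
  "frame_bounds \<Phi> A B \<longleftrightarrow>
     (\<forall>f\<in>carrier_vec (dim_row \<Phi>).
        A * (enorm2 f)\<^sup>2 \<le> (enorm2 (transpose_mat \<Phi> *\<^sub>v f))\<^sup>2 \<and>
        (enorm2 (transpose_mat \<Phi> *\<^sub>v f))\<^sup>2 \<le> B * (enorm2 f)\<^sup>2)"

definition LRIP :: "real mat \<Rightarrow> real \<Rightarrow> real \<Rightarrow> bool" where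
  "LRIP \<Phi> k \<delta> \<longleftrightarrow>
     (\<forall>c\<in>carrier_vec (dim_col \<Phi>). real (nnz c) \<le> k \<longrightarrow>
        (enorm2 (\<Phi> *\<^sub>v c))\<^sup>2 \<ge> (1 - \<delta>) * (enorm2 c)\<^sup>2)"

definition sparse_set :: "real mat \<Rightarrow> nat \<Rightarrow> real Matrix.vec set" where
  "sparse_set \<Phi> k = {\<Phi> *\<^sub>v c | c. c \<in> carrier_vec (dim_col \<Phi>) \<and> nnz c \<le> k}"

definition best_approx :: "real mat \<Rightarrow> nat \<Rightarrow> real Matrix.vec \<Rightarrow> real" where
  "best_approx \<Phi> k f = (INF y\<in>sparse_set \<Phi> k. enorm2 (f - y))"

text \<open>Power of an extended non-negative real, used for positive exponents only.\<close>

definition epowr :: "ennreal \<Rightarrow> real \<Rightarrow> ennreal" where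
  "epowr x a = (if x = \<infinity> then \<infinity> else ennreal (enn2real x powr a))"

text \<open>The sum over k from 1 is shifted to start at 0.\<close>

definition approx_seminorm :: "real mat \<Rightarrow> real \<Rightarrow> real \<Rightarrow> real Matrix.vec \<Rightarrow> ennreal" where
  "approx_seminorm \<Phi> s q f =
     epowr (\<Sum>i. ennreal ((real (Suc i) powr s * best_approx \<Phi> (Suc i) f) powr q / real (Suc i)))
       (1 / q)"

definition approx_norm :: "real mat \<Rightarrow> real \<Rightarrow> real \<Rightarrow> real Matrix.vec \<Rightarrow> ennreal" where
  "approx_norm \<Phi> s q f = ennreal (enorm2 f) + approx_seminorm \<Phi> s q f"

definition approx_space :: "real mat \<Rightarrow> real \<Rightarrow> real \<Rightarrow> real Matrix.vec set" where
  "approx_space \<Phi> s q = {f \<in> carrier_vec (dim_row \<Phi>). approx_norm \<Phi> s q f < \<infinity>}"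

text \<open>The infimum over an empty set of representations is \<open>\<infinity>\<close>.\<close>

definition sparsity_norm :: "real mat \<Rightarrow> real \<Rightarrow> real Matrix.vec \<Rightarrow> ennreal" where
  "sparsity_norm \<Phi> \<tau> f =
     (INF c\<in>{c \<in> carrier_vec (dim_col \<Phi>). \<Phi> *\<^sub>v c = f}. ennreal (lnorm \<tau> c))"

definition sparsity_space :: "real mat \<Rightarrow> real \<Rightarrow> real Matrix.vec set" where
  "sparsity_space \<Phi> \<tau> = {f \<in> carrier_vec (dim_row \<Phi>). sparsity_norm \<Phi> \<tau> f < \<infinity>}"

definition K_functional :: "real mat \<Rightarrow> real \<Rightarrow> real Matrix.vec \<Rightarrow> real \<Rightarrow> ennreal" where
  "K_functional \<Phi> p f t =
     (INF g\<in>sparsity_space \<Phi> p. ennreal (enorm2 (f - g)) + ennreal t * sparsity_norm \<Phi> p g)"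

definition interp_norm ::
    "real mat \<Rightarrow> real \<Rightarrow> real \<Rightarrow> real \<Rightarrow> real Matrix.vec \<Rightarrow> ennreal" where
  "interp_norm \<Phi> p \<theta> q f =
     epowr (\<integral>\<^sup>+t\<in>{0<..}. epowr (ennreal (t powr (- \<theta>)) * K_functional \<Phi> p f t) q * ennreal (1 / t)
              \<partial>lborel)
       (1 / q)"

definition interp_space :: "real mat \<Rightarrow> real \<Rightarrow> real \<Rightarrow> real \<Rightarrow> real Matrix.vec set" where
  "interp_space \<Phi> p \<theta> q = {f \<in> carrier_vec (dim_row \<Phi>). interp_norm \<Phi> p \<theta> q f < \<infinity>}"

definition norms_equiv_on ::
    "'v set \<Rightarrow> real \<Rightarrow> real \<Rightarrow> ('v \<Rightarrow> ennreal) \<Rightarrow> ('v \<Rightarrow> ennreal) \<Rightarrow> bool" where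
  "norms_equiv_on V c C n n' \<longleftrightarrow>
     (\<forall>f\<in>V. ennreal c * n f \<le> n' f \<and> n' f \<le> ennreal C * n f)"

end

(*
The frame bounds give |Phi c| <= sqrt B |c|_2 and, through the canonical dual frame, coefficients of any f
with |c|_2 <= A^(-1/2) |f|. A k-term f with k <= kappa N is handled by LRIP, one with k > kappa N by the dual
coefficients; Hoelder then yields the Bernstein inequality with the stated constant.

The three quasi-norms are compared in a cycle, with rho = 1/p - 1/2 = r/theta.
l^tau <= C A^r_tau: telescope near-best 2^j-term approximants and apply Bernstein to the differences.
A^r_tau <= C interpolation: Jackson for l^p gives sigma_k(f) <= C K(f, t) for t >= k^(-rho), and the integral
dominates the corresponding dyadic sum.
Interpolation <= C l^tau: for f = Phi c, keeping the 2^j largest entries of c bounds K(f, 2^(-j rho)) by an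
l^2 tail and an l^p head of the decreasing rearrangement of c, and both are summed by Hardy inequalities.
*)
theory Submission
  imports Defs "Jordan_Normal_Form.Determinant"
begin


section \<open>Dyadic sums and Hardy inequalities\<close>

text \<open>Constants free of \<open>N\<close> shape the statements: each of the three comparisons
  puts \<open>\<exists>C>0\<close> in front of the quantifiers over \<open>m\<close>,
  \<open>N\<close> and \<open>\<Phi>\<close>, and \<open>N\<close> only truncates sums that are
  bounded by a quantity independent of the truncation.

  Since \<tau> \<le> 1, the estimates are made for \<tau>-th powers of quasi-norms, which are
  subadditive with constant 1; a quasi-triangle inequality would lose a factor at every telescoping
  step.

  Two identities make the dyadic scales fit. First, r \<tau> = 1 - \<tau>/2 \<le> 1, so the terms of
  the approximation seminorm decrease in k and Cauchy condensation applies. Secondly, r = \<theta>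
  \<rho>, so at t = (2^j)^(-\<rho>) the interpolation weight t^(-\<theta>) equals the approximation
  weight (2^j)^r.

  The delicate sum is the head: its outer exponent \<tau>/p exceeds 1, so subadditivity is lost, and
  only the decay of the weights pays for a cruder splitting.\<close>

lemma dyadic_block_le:
  fixes g :: "nat \<Rightarrow> real"
  assumes "\<And>i j. 0 < i \<Longrightarrow> i \<le> j \<Longrightarrow> g j \<le> g i"
  shows "(\<Sum>i\<in>{2^j..<2^Suc j}. g i) \<le> 2^j * g (2^j)"
proof -
  have "(\<Sum>i\<in>{2^j..<2^Suc j}. g i) \<le> of_nat (card {2^j..<(2::nat)^Suc j}) * g (2^j)"
    by (rule sum_bounded_above) (auto intro: assms)
  then show ?thesis by simp
qed

text \<open>The block is closed on the right, so its smallest value sits at \<open>2^Suc j\<close>.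
  Its length is half of that index, which is the origin of the factor 2 in
  \<open>dyadic_condensation_ge\<close>.\<close>

lemma dyadic_block_ge:
  fixes g :: "nat \<Rightarrow> real"
  assumes "\<And>i j. 0 < i \<Longrightarrow> i \<le> j \<Longrightarrow> g j \<le> g i"
  shows "2^j * g (2^Suc j) \<le> (\<Sum>i\<in>{2^j<..2^Suc j}. g i)"
proof -
  have "of_nat (card {2^j<..(2::nat)^Suc j}) * g (2^Suc j) \<le> (\<Sum>i\<in>{2^j<..2^Suc j}. g i)"
    by (rule sum_bounded_below) (auto intro: assms order.strict_trans1[of 0])
  then show ?thesis by simp
qed

lemma dyadic_condensation_le:
  fixes g :: "nat \<Rightarrow> real"
  assumes "\<And>i j. 0 < i \<Longrightarrow> i \<le> j \<Longrightarrow> g j \<le> g i"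
  shows "(\<Sum>i\<in>{1..<2^L}. g i) \<le> (\<Sum>l<L. 2^l * g (2^l))"
proof (induction L)
  case (Suc L)
  have "(\<Sum>i\<in>{1..<2^Suc L}. g i) = (\<Sum>i\<in>{1..<2^L}. g i) + (\<Sum>i\<in>{2^L..<2^Suc L}. g i)"
    by (rule sum.atLeastLessThan_concat[symmetric]) auto
  then show ?case using Suc dyadic_block_le[of g L] assms by simp
qed simp

lemma dyadic_condensation_ge:
  fixes g :: "nat \<Rightarrow> real"
  assumes "\<And>i j. 0 < i \<Longrightarrow> i \<le> j \<Longrightarrow> g j \<le> g i" and "0 \<le> g 1"
  shows "(\<Sum>l\<le>L. 2^l * g (2^l)) \<le> 2 * (\<Sum>i\<in>{1..2^L}. g i)"
proof (induction L)
  case 0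
  then show ?case using assms(2) by simp
next
  case (Suc L)
  have "{1..2^Suc L} = {1..2^L} \<union> {(2::nat)^L<..2^Suc L}" by (auto simp: le_Suc_eq)
  then have "(\<Sum>i\<in>{1..2^Suc L}. g i) = (\<Sum>i\<in>{1..2^L}. g i) + (\<Sum>i\<in>{2^L<..2^Suc L}. g i)"
    by (simp only:) (rule sum.union_disjoint, auto)
  then show ?case using Suc dyadic_block_ge[of g L] assms(1) by simp
qed

text \<open>Dividing by \<open>a + b\<close> reduces this to \<open>x \<le> x powr s\<close> on the
  unit interval.\<close>

lemma powr_add_le:
  fixes a b s :: real
  assumes "0 \<le> a" "0 \<le> b" "0 < s" "s \<le> 1"
  shows "(a + b) powr s \<le> a powr s + b powr s"
proof (cases "a + b = 0")
  case True
  then have "a = 0" "b = 0" using assms by auto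
  then show ?thesis by simp
next
  case False
  let ?c = "a + b"
  have pos: "0 < ?c" using False assms by simp
  have *: "x / ?c \<le> (x / ?c) powr s" if "0 \<le> x" "x \<le> ?c" for x
  proof (cases "x = 0")
    case False
    then have "(x / ?c) powr 1 \<le> (x / ?c) powr s"
      using that pos assms by (intro powr_mono') auto
    then show ?thesis using that pos by simp
  qed simp
  have "1 = a / ?c + b / ?c" using pos by (simp add: add_divide_distrib[symmetric])
  also have "\<dots> \<le> (a / ?c) powr s + (b / ?c) powr s"
    using *[of a] *[of b] assms by simp
  also have "\<dots> = (a powr s + b powr s) / ?c powr s"
    using assms pos by (simp add: powr_divide add_divide_distrib)
  finally show ?thesis using pos by (simp add: field_simps)
qed

text \<open>A crude substitute for convexity when \<open>s > 1\<close>: for small \<open>\<eta>\<close> the factor of the first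
  summand is close to 1, so a power of partial sums with decaying weights still contracts.\<close>

lemma powr_add_le_scaled:
  fixes a b s :: real
  assumes "0 \<le> a" "0 \<le> b" "0 < s" "0 < \<eta>"
  shows "(a + b) powr s \<le> (1 + \<eta>) powr s * a powr s + (1 + 1 / \<eta>) powr s * b powr s"
proof (cases "b \<le> \<eta> * a")
  case True
  then have "(a + b) powr s \<le> ((1 + \<eta>) * a) powr s"
    using assms by (intro powr_mono2) (auto simp: algebra_simps)
  then show ?thesis using assms by (simp add: powr_mult add_increasing2)
next
  case False
  then have "(a + b) powr s \<le> ((1 + 1 / \<eta>) * b) powr s"
    using assms by (intro powr_mono2) (auto simp: field_simps)
  then show ?thesis using assms by (simp add: powr_mult add_increasing)
qed

lemma powr_add_le_two:
  fixes a b s :: real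
  assumes "0 \<le> a" "0 \<le> b" "0 < s"
  shows "(a + b) powr s \<le> 2 powr s * (a powr s + b powr s)"
  using powr_add_le_scaled[OF assms, of 1] by (simp add: distrib_left)

lemma powr_pow:
  fixes x a :: real
  assumes "0 < x"
  shows "(x ^ j) powr a = (x powr a) ^ j"
  using assms by (simp add: powr_realpow[symmetric] powr_powr mult.commute flip: powr_realpow)

lemma powr_two_pow: "real (2 ^ j) powr a = (2 powr a) ^ j"
  by (simp add: powr_pow)

lemma sum_powr_le_card:
  fixes x :: "'a \<Rightarrow> real"
  assumes "finite S" "card S \<le> k" "\<And>i. i \<in> S \<Longrightarrow> 0 \<le> x i" "0 < a" "a \<le> 1"
  shows "(\<Sum>i\<in>S. x i powr a) \<le> real k powr (1 - a) * (\<Sum>i\<in>S. x i) powr a"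
proof (cases "(\<Sum>i\<in>S. x i) = 0")
  case True
  then have "\<forall>i\<in>S. x i = 0" using assms by (simp add: sum_nonneg_eq_0_iff)
  then show ?thesis by simp
next
  case False
  then have X: "0 < (\<Sum>i\<in>S. x i)" using assms by (simp add: sum_nonneg order_less_le)
  then have "S \<noteq> {}" by auto
  then have k: "0 < real k" using assms by (auto simp: card_gt_0_iff intro: order.strict_trans2)
  \<comment> \<open>The mean over \<open>k\<close> slots. Young's inequality against this value is
    an equality when \<open>k\<close> equal summands are present, so Hoelder's inequality comes out
    with constant 1, as the exact Bernstein constant requires.\<close>
  define M where "M = (\<Sum>i\<in>S. x i) / real k"
  have M: "0 < M" using X k by (simp add: M_def)
  have "(\<Sum>i\<in>S. x i powr a) * M powr (1 - a) = (\<Sum>i\<in>S. x i powr a * M powr (1 - a))"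
    by (rule sum_distrib_right)
  also have "\<dots> \<le> (\<Sum>i\<in>S. a * x i + (1 - a) * M)"
  proof (rule sum_mono)
    fix i assume "i \<in> S"
    then show "x i powr a * M powr (1 - a) \<le> a * x i + (1 - a) * M"
      using assms M Youngs_inequality_0[of a "1 - a" "x i" M]
      by (cases "x i = 0") (auto simp: order_less_le)
  qed
  also have "\<dots> = a * (k * M) + real (card S) * ((1 - a) * M)"
    using k by (simp add: sum.distrib sum_distrib_left[symmetric] M_def)
  also have "\<dots> \<le> a * (k * M) + real k * ((1 - a) * M)"
    using assms M by (intro add_left_mono mult_right_mono) auto
  also have "\<dots> = k * M powr a * M powr (1 - a)"
    using M by (simp add: powr_add[symmetric] algebra_simps)
  finally have "(\<Sum>i\<in>S. x i powr a) \<le> k * M powr a" using M by simp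
  also have "\<dots> = real k powr (1 - a) * (\<Sum>i\<in>S. x i) powr a"
    using X k by (simp add: M_def powr_divide powr_diff)
  finally show ?thesis .
qed

section \<open>Hardy inequalities by contraction\<close>

lemma sum_le_of_contraction:
  fixes E X :: "nat \<Rightarrow> real"
  assumes "0 \<le> s" "s < 1" "\<And>j. 0 \<le> E j" "E 0 \<le> X 0" "\<And>j. E (Suc j) \<le> s * E j + X (Suc j)"
  shows "(\<Sum>j<J. E j) \<le> (\<Sum>j<J. X j) / (1 - s)"
proof (cases J)
  case (Suc K)
  have "(\<Sum>j<Suc K. E j) \<le> X 0 + (\<Sum>j<K. s * E j + X (Suc j))"
    unfolding sum.lessThan_Suc_shift by (intro add_mono sum_mono assms)
  also have "\<dots> = (\<Sum>j<Suc K. X j) + s * (\<Sum>j<K. E j)"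
    unfolding sum.lessThan_Suc_shift by (simp add: sum.distrib sum_distrib_left)
  also have "\<dots> \<le> (\<Sum>j<Suc K. X j) + s * (\<Sum>j<Suc K. E j)"
    using assms by (intro add_left_mono mult_left_mono) auto
  finally show ?thesis using assms(2) Suc by (simp add: field_simps)
qed simp

text \<open>The mirror image of the forward version, with a vanishing last term in place of an
  initial bound. In both, summing the recursion reproduces the sum on the right with factor
  \<open>s < 1\<close>; the sum being finite, it can be absorbed on the left.\<close>

lemma sum_le_of_backward_contraction:
  fixes E X :: "nat \<Rightarrow> real"
  assumes "0 \<le> s" "s < 1" "\<And>j. 0 \<le> E j" "\<And>j. E j \<le> s * E (Suc j) + X j" "E J = 0"
  shows "(\<Sum>j<J. E j) \<le> (\<Sum>j<J. X j) / (1 - s)"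
proof -
  have "(\<Sum>j<J. E j) \<le> s * (\<Sum>j<J. E (Suc j)) + (\<Sum>j<J. X j)"
    unfolding sum_distrib_left sum.distrib[symmetric] by (intro sum_mono assms)
  moreover have "(\<Sum>j<J. E (Suc j)) \<le> (\<Sum>j<J. E j)"
    using sum.lessThan_Suc_shift[of E J] assms(3)[of 0] assms(5) by simp
  ultimately have "(\<Sum>j<J. E j) \<le> s * (\<Sum>j<J. E j) + (\<Sum>j<J. X j)"
    using mult_left_mono[OF _ assms(1)] by (meson add_right_mono order_trans)
  then show ?thesis using assms(2) by (simp add: field_simps)
qed

lemma dyadic_values_le_sum:
  fixes b :: "nat \<Rightarrow> real"
  assumes "\<And>i. 0 \<le> b i" "antimono b" "\<And>i. N \<le> i \<Longrightarrow> b i = 0" "0 < \<tau>"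
  shows "(\<Sum>l<L. 2^l * b (2^l) powr \<tau>) \<le> 2 * (\<Sum>i<N. b i powr \<tau>)"
proof -
  have mono: "b j powr \<tau> \<le> b i powr \<tau>" if "i \<le> j" for i j
    using assms antimonoD[OF assms(2) that] by (intro powr_mono2) auto
  have "(\<Sum>l<L. 2^l * b (2^l) powr \<tau>) \<le> (\<Sum>l\<le>L. 2^l * b (2^l) powr \<tau>)"
    by (rule sum_mono2) auto
  also have "\<dots> \<le> 2 * (\<Sum>i\<in>{1..2^L}. b i powr \<tau>)"
    by (rule dyadic_condensation_ge) (auto intro: mono)
  also have "(\<Sum>i\<in>{1..2^L}. b i powr \<tau>) \<le> (\<Sum>i<N. b i powr \<tau>)"
  proof -
    have "(\<Sum>i\<in>{1..2^L}. b i powr \<tau>) = (\<Sum>i\<in>{1..2^L} \<inter> {..<N}. b i powr \<tau>)"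
      by (rule sum.mono_neutral_right) (use assms in \<open>auto simp: not_less\<close>)
    also have "\<dots> \<le> (\<Sum>i<N. b i powr \<tau>)" by (rule sum_mono2) auto
    finally show ?thesis .
  qed
  finally show ?thesis by simp
qed

text \<open>Each tail is a dyadic block plus the next tail. As \<open>\<tau>/2 < 1\<close>, the
  power is subadditive, and as the weights grow by \<open>w > 1\<close>, the next weighted tail
  enters with factor \<open>1/w\<close>. The weight is the one for which a block contributes exactly
  \<open>2^j * b (2^j) powr \<tau>\<close>.\<close>

lemma hardy_tail_sum:
  fixes b :: "nat \<Rightarrow> real"
  assumes b: "\<And>i. 0 \<le> b i" "antimono b" "\<And>i. N \<le> i \<Longrightarrow> b i = 0" and \<tau>: "0 < \<tau>" "\<tau> < 2"
  shows "(\<Sum>j<J. (2 powr (1 - \<tau>/2))^j * (\<Sum>i\<in>{2^j..<N}. (b i)\<^sup>2) powr (\<tau>/2))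
    \<le> 2 / (1 - 2 powr (\<tau>/2 - 1)) * (\<Sum>i<N. b i powr \<tau>)"
proof -
  define w where "w = 2 powr (1 - \<tau>/2)"
  define T where "T j = (\<Sum>i\<in>{2^j..<N}. (b i)\<^sup>2)" for j
  \<comment> \<open>The sum is prolonged until the tail is empty, which gives the vanishing last
    term of the backward contraction. The bound obtained does not depend on
    \<open>L\<close>.\<close>
  define L where "L = J + N"
  have w: "1 < w" using \<tau> by (simp add: w_def)
  have inv: "1 / w = 2 powr (\<tau>/2 - 1)" by (simp add: w_def flip: powr_minus_divide)
  have T0: "0 \<le> T j" for j by (auto simp: T_def intro: sum_nonneg)
  have NL: "N \<le> 2^L"
    using less_exp[of L] unfolding L_def by linarith
  have step: "T j powr (\<tau>/2) \<le> (2^j * (b (2^j))\<^sup>2) powr (\<tau>/2) + T (Suc j) powr (\<tau>/2)" for j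
  proof -
    have "T j \<le> (\<Sum>i\<in>{2^j..<2^Suc j} \<union> {2^Suc j..<N}. (b i)\<^sup>2)"
      unfolding T_def by (rule sum_mono2) auto
    also have "\<dots> = (\<Sum>i\<in>{2^j..<2^Suc j}. (b i)\<^sup>2) + T (Suc j)"
      unfolding T_def by (rule sum.union_disjoint) auto
    also have "(\<Sum>i\<in>{2^j..<2^Suc j}. (b i)\<^sup>2) \<le> 2^j * (b (2^j))\<^sup>2"
      by (rule dyadic_block_le) (use b antimonoD[OF b(2)] in \<open>auto intro: power_mono\<close>)
    finally have "T j powr (\<tau>/2) \<le> (2^j * (b (2^j))\<^sup>2 + T (Suc j)) powr (\<tau>/2)"
      using \<tau> T0 by (intro powr_mono2) auto
    also have "\<dots> \<le> (2^j * (b (2^j))\<^sup>2) powr (\<tau>/2) + T (Suc j) powr (\<tau>/2)"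
      using \<tau> T0 by (intro powr_add_le) auto
    finally show ?thesis .
  qed
  have blk: "w^j * (2^j * (b (2^j))\<^sup>2) powr (\<tau>/2) = 2^j * b (2^j) powr \<tau>" for j
  proof -
    have "(b (2^j))\<^sup>2 powr (\<tau>/2) = b (2^j) powr \<tau>"
      using b(1)[of "2^j"] by (simp add: powr_powr flip: powr_numeral)
    then show ?thesis
      by (simp add: powr_mult powr_pow w_def power_mult_distrib[symmetric] powr_add[symmetric]
          mult.assoc[symmetric])
  qed
  have "(\<Sum>j<J. w^j * T j powr (\<tau>/2)) \<le> (\<Sum>j<L. w^j * T j powr (\<tau>/2))"
    by (rule sum_mono2) (use w in \<open>auto simp: L_def\<close>)
  also have "\<dots> \<le> (\<Sum>j<L. 2^j * b (2^j) powr \<tau>) / (1 - 1/w)"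
  proof (rule sum_le_of_backward_contraction)
    fix j
    have "w^j * T j powr (\<tau>/2) \<le> w^j * ((2^j * (b (2^j))\<^sup>2) powr (\<tau>/2) + T (Suc j) powr (\<tau>/2))"
      using step w by (intro mult_left_mono) auto
    also have "\<dots> = 1/w * (w^Suc j * T (Suc j) powr (\<tau>/2)) + 2^j * b (2^j) powr \<tau>"
      using w by (simp add: distrib_left blk)
    finally show "w^j * T j powr (\<tau>/2) \<le> 1/w * (w^Suc j * T (Suc j) powr (\<tau>/2)) + 2^j * b (2^j) powr \<tau>" .
  next
    show "w^L * T L powr (\<tau>/2) = 0" using NL by (simp add: T_def)
  qed (use w in auto)
  also have "\<dots> \<le> (2 * (\<Sum>i<N. b i powr \<tau>)) / (1 - 1/w)"
    using w by (intro divide_right_mono dyadic_values_le_sum b \<tau>) auto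
  finally show ?thesis unfolding inv by (simp add: w_def T_def)
qed

text \<open>The power \<open>\<tau>/p > 1\<close> is not subadditive. The weights, however, shrink
  by the factor \<open>x < 1\<close> at each step, and half of this gain (in the exponent) is spent
  on the loss \<open>(1 + \<eta>) powr q\<close>. The constant depends on \<open>p\<close> and
  \<open>\<tau>\<close> alone, hence its place before \<open>b\<close>, \<open>N\<close> and
  \<open>J\<close>.\<close>

lemma hardy_head_sum:
  assumes p: "0 < p" "p < \<tau>"
  shows "\<exists>C>0. \<forall>(b::nat \<Rightarrow> real) N J. (\<forall>i. 0 \<le> b i) \<and> antimono b \<and> (\<forall>i\<ge>N. b i = 0) \<longrightarrow>
    (\<Sum>j<J. (2 powr (1 - \<tau>/p))^j * (\<Sum>i<2^j. b i powr p) powr (\<tau>/p)) \<le> C * (\<Sum>i<N. b i powr \<tau>)"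
proof -
  define q where "q = \<tau>/p"
  define x where "x = 2 powr (1 - q)"
  \<comment> \<open>chosen such that \<open>x * (1 + \<eta>) powr q = sqrt x < 1\<close>\<close>
  define \<eta> where "\<eta> = (1/x) powr (1/(2*q)) - 1"
  define D where "D = 1 + (1 + 1/\<eta>) powr q"
  define s where "s = x * (1 + \<eta>) powr q"
  have q: "1 < q" using p by (simp add: q_def)
  have x: "0 < x" "x < 1" using q by (auto simp: x_def powr_less_one)
  have \<eta>: "0 < \<eta>" using x q by (simp add: \<eta>_def)
  have s_eq: "s = x powr (1/2)"
  proof -
    have "(1 + \<eta>) powr q = x powr (- (1/2))"
      using x q by (simp add: \<eta>_def powr_powr powr_divide powr_minus divide_simps)
    then show ?thesis using x by (simp add: s_def powr_mult_base)
  qed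
  have s: "0 < s" "s < 1" using x powr_less_mono2[of "1/2" x 1] by (auto simp: s_eq)
  have D: "1 \<le> D" by (simp add: D_def)
  show ?thesis
  proof (intro exI[of _ "3 * D / (1 - s)"] conjI allI impI)
    show "0 < 3 * D / (1 - s)" using D s by simp
    fix b :: "nat \<Rightarrow> real" and N J
    assume "(\<forall>i. 0 \<le> b i) \<and> antimono b \<and> (\<forall>i\<ge>N. b i = 0)"
    then have b: "\<And>i. 0 \<le> b i" "antimono b" "\<And>i. N \<le> i \<Longrightarrow> b i = 0" by auto
    have mono: "b j powr p \<le> b i powr p" if "i \<le> j" for i j
      using b p antimonoD[OF b(2) that] by (intro powr_mono2) auto
    define H where "H j = (\<Sum>i<2^j. b i powr p)" for j
    \<comment> \<open>\<open>H 0\<close> is the single term with index 0, and the blocks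
      \<open>{2^l..<2^Suc l}\<close> start at index 1. So \<open>b 0\<close> needs its own entry,
      and block \<open>l\<close> is charged to position \<open>Suc l\<close>.\<close>
    define X where "X j = (case j of 0 \<Rightarrow> b 0 powr \<tau> | Suc l \<Rightarrow> D * (2^l * b (2^l) powr \<tau>))" for j
    have H0: "0 \<le> H j" for j by (auto simp: H_def intro: sum_nonneg)
    have "(\<Sum>j<J. x^j * H j powr q) \<le> (\<Sum>j<J. X j) / (1 - s)"
    proof (rule sum_le_of_contraction)
      show "x^0 * H 0 powr q \<le> X 0"
        using p by (simp add: H_def X_def q_def powr_powr)
      fix j
      have "H (Suc j) = H j + (\<Sum>i\<in>{2^j..<2^Suc j}. b i powr p)"
        unfolding H_def lessThan_atLeast0 by (rule sum.atLeastLessThan_concat[symmetric]) auto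
      also have "(\<Sum>i\<in>{2^j..<2^Suc j}. b i powr p) \<le> 2^j * b (2^j) powr p"
        by (rule dyadic_block_le) (auto intro: mono)
      finally have "H (Suc j) powr q \<le> (H j + 2^j * b (2^j) powr p) powr q"
        using H0 q by (intro powr_mono2) auto
      also have "\<dots> \<le> (1 + \<eta>) powr q * H j powr q + (1 + 1/\<eta>) powr q * (2^j * b (2^j) powr p) powr q"
        using H0 q \<eta> by (intro powr_add_le_scaled) auto
      finally have "x^Suc j * H (Suc j) powr q \<le>
        x^Suc j * ((1 + \<eta>) powr q * H j powr q + (1 + 1/\<eta>) powr q * (2^j * b (2^j) powr p) powr q)"
        using x by (intro mult_left_mono) auto
      also have "\<dots> = s * (x^j * H j powr q) + x * (1 + 1/\<eta>) powr q * (x^j * (2^j * b (2^j) powr p) powr q)"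
        by (simp add: s_def algebra_simps)
      also have "x^j * (2^j * b (2^j) powr p) powr q = 2^j * b (2^j) powr \<tau>"
        using p by (simp add: powr_mult powr_pow x_def power_mult_distrib[symmetric] powr_add[symmetric]
          mult.assoc[symmetric] powr_powr q_def)
      also have "x * (1 + 1/\<eta>) powr q * (2^j * b (2^j) powr \<tau>) \<le> D * (2^j * b (2^j) powr \<tau>)"
      proof (rule mult_right_mono)
        have "x * (1 + 1/\<eta>) powr q \<le> 1 * (1 + 1/\<eta>) powr q" using x by (intro mult_right_mono) auto
        then show "x * (1 + 1/\<eta>) powr q \<le> D" by (simp add: D_def)
      qed simp
      finally show "x^Suc j * H (Suc j) powr q \<le> s * (x^j * H j powr q) + X (Suc j)"
        by (simp add: X_def)
    qed (use s x in auto)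
    also have "(\<Sum>j<J. X j) \<le> (\<Sum>j<Suc J. X j)"
      by (rule sum_mono2) (use D in \<open>auto simp: X_def split: nat.splits\<close>)
    also have "(\<Sum>j<Suc J. X j) = b 0 powr \<tau> + D * (\<Sum>l<J. 2^l * b (2^l) powr \<tau>)"
      unfolding sum.lessThan_Suc_shift by (simp add: X_def sum_distrib_left)
    \<comment> \<open>This is the 3 in the constant: one \<open>D\<close> for \<open>b 0\<close>,
      which the values \<open>b (2^l)\<close> do not dominate, and two from condensation.\<close>
    also have "\<dots> \<le> D * (\<Sum>i<N. b i powr \<tau>) + D * (2 * (\<Sum>i<N. b i powr \<tau>))"
    proof (intro add_mono mult_left_mono dyadic_values_le_sum b)
      have "b 0 powr \<tau> \<le> (\<Sum>i<N. b i powr \<tau>)"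
      proof (cases "N = 0")
        case False
        then show ?thesis using member_le_sum[of 0 "{..<N}" "\<lambda>i. b i powr \<tau>"] by auto
      qed (use b in auto)
      then show "b 0 powr \<tau> \<le> D * (\<Sum>i<N. b i powr \<tau>)"
        using mult_right_mono[OF D, of "\<Sum>i<N. b i powr \<tau>"] by (simp add: sum_nonneg)
    qed (use D p in auto)
    finally show "(\<Sum>j<J. (2 powr (1 - \<tau>/p))^j * (\<Sum>i<2^j. b i powr p) powr (\<tau>/p))
        \<le> 3 * D / (1 - s) * (\<Sum>i<N. b i powr \<tau>)"
      using s by (simp add: x_def q_def H_def divide_right_mono)
  qed
qed


section \<open>Norms of coefficient vectors\<close>

lemma enorm2_nonneg [simp]: "0 \<le> enorm2 v"
  by (simp add: enorm2_def)

lemma enorm2_power2: "(enorm2 v)\<^sup>2 = (\<Sum>i<dim_vec v. (vec_index v i)\<^sup>2)"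
  by (simp add: enorm2_def L2_set_def sum_nonneg)

lemma enorm2_power2_scalar_prod: "(enorm2 v)\<^sup>2 = scalar_prod v v"
  unfolding enorm2_power2 by (simp add: scalar_prod_def atLeast0LessThan power2_eq_square)

lemma enorm2_zero [simp]: "enorm2 (0\<^sub>v n) = 0"
  by (simp add: enorm2_def L2_set_def)

lemma enorm2_eq_0_iff:
  assumes "v \<in> carrier_vec n"
  shows "enorm2 v = 0 \<longleftrightarrow> v = 0\<^sub>v n"
  using assms by (auto simp: enorm2_def L2_set_eq_0_iff)

lemma enorm2_add:
  assumes "v \<in> carrier_vec n" "w \<in> carrier_vec n"
  shows "enorm2 (v + w) \<le> enorm2 v + enorm2 w"
proof -
  have "enorm2 (v + w) = L2_set (\<lambda>i. vec_index v i + vec_index w i) {..<n}"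
    using assms unfolding enorm2_def by (intro L2_set_cong) auto
  then show ?thesis
    using L2_set_triangle_ineq[of "vec_index v" "vec_index w" "{..<n}"] assms by (auto simp: enorm2_def)
qed

lemma enorm2_diff_commute:
  assumes "v \<in> carrier_vec n" "w \<in> carrier_vec n"
  shows "enorm2 (v - w) = enorm2 (w - v)"
proof -
  have "(enorm2 (v - w))\<^sup>2 = (enorm2 (w - v))\<^sup>2"
    using assms by (auto simp: enorm2_power2 power2_commute intro!: sum.cong)
  then show ?thesis by (simp add: power2_eq_iff_nonneg)
qed

lemma enorm2_triangle:
  assumes "u \<in> carrier_vec n" "v \<in> carrier_vec n" "w \<in> carrier_vec n"
  shows "enorm2 (u - w) \<le> enorm2 (u - v) + enorm2 (v - w)"
proof -
  have "u - w = (u - v) + (v - w)" using assms by (intro eq_vecI) auto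
  then show ?thesis using enorm2_add[of "u - v" n "v - w"] assms by simp
qed

lemma scalar_prod_le_enorm2:
  assumes "v \<in> carrier_vec n" "w \<in> carrier_vec n"
  shows "scalar_prod v w \<le> enorm2 v * enorm2 w"
proof -
  have "scalar_prod v w \<le> (\<Sum>i<n. \<bar>vec_index v i\<bar> * \<bar>vec_index w i\<bar>)"
    using assms by (auto simp: scalar_prod_def lessThan_atLeast0 abs_mult[symmetric] intro!: sum_mono)
  also have "\<dots> \<le> enorm2 v * enorm2 w"
    using L2_set_mult_ineq[of "vec_index v" "vec_index w" "{..<n}"] assms by (simp add: enorm2_def)
  finally show ?thesis .
qed

text \<open>The outer root is omitted because for \<open>s \<le> 1\<close> this expression is
  subadditive with constant 1, whereas \<open>lnorm\<close> with \<open>s < 1\<close> is only a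
  quasi-norm.\<close>

definition psum :: "real \<Rightarrow> real Matrix.vec \<Rightarrow> real" where
  "psum s c = (\<Sum>j<dim_vec c. \<bar>vec_index c j\<bar> powr s)"

lemma psum_nonneg [simp]: "0 \<le> psum s c"
  by (simp add: psum_def sum_nonneg)

lemma lnorm_psum: "lnorm s c = psum s c powr (1 / s)"
  by (simp add: lnorm_def psum_def)

lemma psum_add:
  assumes "v \<in> carrier_vec n" "w \<in> carrier_vec n" "0 < s" "s \<le> 1"
  shows "psum s (v + w) \<le> psum s v + psum s w"
proof -
  have "psum s (v + w) \<le> (\<Sum>i<n. \<bar>vec_index v i\<bar> powr s + \<bar>vec_index w i\<bar> powr s)"
    unfolding psum_def
  proof (rule sum_le_included[where i = "\<lambda>x. x"])
    show "\<forall>i\<in>{..<dim_vec (v + w)}. \<exists>j\<in>{..<n}. j = i \<and> \<bar>vec_index (v + w) i\<bar> powr s \<le>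
        \<bar>vec_index v j\<bar> powr s + \<bar>vec_index w j\<bar> powr s"
    proof
      fix i assume "i \<in> {..<dim_vec (v + w)}"
      moreover have "\<bar>vec_index v i + vec_index w i\<bar> powr s \<le> (\<bar>vec_index v i\<bar> + \<bar>vec_index w i\<bar>) powr s"
        using assms by (intro powr_mono2) auto
      ultimately show "\<exists>j\<in>{..<n}. j = i \<and> \<bar>vec_index (v + w) i\<bar> powr s \<le>
          \<bar>vec_index v j\<bar> powr s + \<bar>vec_index w j\<bar> powr s"
        using assms powr_add_le[of "\<bar>vec_index v i\<bar>" "\<bar>vec_index w i\<bar>" s] by auto
    qed
  qed auto
  then show ?thesis using assms by (simp add: psum_def sum.distrib)
qed

lemma power2_powr_half: "(x\<^sup>2) powr (s / 2) = \<bar>x\<bar> powr s" for x :: real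
proof -
  have "x\<^sup>2 = \<bar>x\<bar> powr 2" by simp
  then show ?thesis by (simp only: powr_powr) simp
qed

text \<open>Hoelder's inequality on the support, applied to the squares of the entries with exponent
  \<open>s/2\<close>. It serves both sparse coefficients and, with \<open>k = N\<close>, arbitrary
  ones.\<close>

lemma lnorm_le_enorm2:
  assumes "nnz c \<le> k" "0 < s" "s \<le> 2"
  shows "lnorm s c \<le> real k powr (1/s - 1/2) * enorm2 c"
proof -
  define S where "S = {j. j < dim_vec c \<and> vec_index c j \<noteq> 0}"
  have "psum s c = (\<Sum>j\<in>S. ((vec_index c j)\<^sup>2) powr (s/2))"
    unfolding psum_def S_def by (rule sum.mono_neutral_cong_right) (auto simp: power2_powr_half)
  also have "\<dots> \<le> real k powr (1 - s/2) * (\<Sum>j\<in>S. (vec_index c j)\<^sup>2) powr (s/2)"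
    by (rule sum_powr_le_card) (use assms in \<open>auto simp: S_def nnz_def\<close>)
  also have "(\<Sum>j\<in>S. (vec_index c j)\<^sup>2) = (enorm2 c)\<^sup>2"
    unfolding enorm2_power2 S_def by (rule sum.mono_neutral_left) auto
  finally have "lnorm s c \<le> (real k powr (1 - s/2) * ((enorm2 c)\<^sup>2) powr (s/2)) powr (1/s)"
    unfolding lnorm_psum using assms by (intro powr_mono2) auto
  also have "\<dots> = real k powr ((1 - s/2) * (1/s)) * ((enorm2 c)\<^sup>2) powr (1/2)"
    using assms by (simp add: powr_mult powr_powr)
  also have "(1 - s/2) * (1/s) = 1/s - 1/2" using assms by (simp add: field_simps)
  also have "((enorm2 c)\<^sup>2) powr (1/2) = enorm2 c" by (simp add: powr_half_sqrt)
  finally show ?thesis .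
qed

text \<open>The \<open>s\<close>-th power of a single entry is at most \<open>psum s c\<close>, so
  the surplus exponent \<open>t - s\<close> can be pulled out of the sum.\<close>

lemma lnorm_antimono:
  assumes "0 < s" "s \<le> t"
  shows "lnorm t c \<le> lnorm s c"
proof -
  define M where "M = psum s c"
  have M: "0 \<le> M" by (simp add: M_def)
  have "\<bar>vec_index c j\<bar> powr t \<le> \<bar>vec_index c j\<bar> powr s * M powr (t/s - 1)" if "j < dim_vec c" for j
  proof -
    have "\<bar>vec_index c j\<bar> powr s \<le> M"
      unfolding M_def psum_def by (rule member_le_sum) (use that in auto)
    then have "(\<bar>vec_index c j\<bar> powr s) powr (t/s - 1) \<le> M powr (t/s - 1)"
      using assms by (intro powr_mono2) auto
    then have "\<bar>vec_index c j\<bar> powr s * (\<bar>vec_index c j\<bar> powr s) powr (t/s - 1)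
        \<le> \<bar>vec_index c j\<bar> powr s * M powr (t/s - 1)"
      by (rule mult_left_mono) simp
    then show ?thesis using assms by (simp add: powr_powr powr_add[symmetric] right_diff_distrib)
  qed
  then have "psum t c \<le> M * M powr (t/s - 1)"
    unfolding psum_def M_def sum_distrib_right by (intro sum_mono) auto
  also have "\<dots> = M powr (t/s)" using M by (cases "M = 0") (auto simp: powr_diff)
  finally have "lnorm t c \<le> (M powr (t/s)) powr (1/t)"
    unfolding lnorm_psum using assms by (intro powr_mono2) auto
  then show ?thesis using assms by (simp add: lnorm_psum M_def powr_powr)
qed

text \<open>\<open>b\<close> is padded with zeros and \<open>h k\<close>, the truncation to the
  \<open>k\<close> largest entries, exists for every \<open>k\<close>; dyadic indices beyond
  \<open>N\<close> therefore need no special treatment later.\<close>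

lemma decreasing_rearrangement:
  fixes c :: "real Matrix.vec"
  assumes c: "c \<in> carrier_vec N"
  obtains b :: "nat \<Rightarrow> real" and h :: "nat \<Rightarrow> real Matrix.vec"
  where "\<And>i. 0 \<le> b i" "antimono b" "\<And>i. N \<le> i \<Longrightarrow> b i = 0"
    and "\<And>k. h k \<in> carrier_vec N" "\<And>k. nnz (h k) \<le> k"
    and "\<And>k s. psum s (h k) = (\<Sum>i<k. b i powr s)"
    and "\<And>k. (enorm2 (c - h k))\<^sup>2 = (\<Sum>i\<in>{k..<N}. (b i)\<^sup>2)"
    and "\<And>s. psum s c = (\<Sum>i<N. b i powr s)"
proof -
  \<comment> \<open>Positions are sorted rather than moduli: this breaks ties, so the first
    \<open>k\<close> positions carry exactly the values \<open>b i\<close> with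
    \<open>i < k\<close>.\<close>
  define xs where "xs = sort_key (\<lambda>i. - \<bar>vec_index c i\<bar>) [0..<N]"
  have len: "length xs = N" and set: "set xs = {..<N}" and dist: "distinct xs"
    by (auto simp: xs_def)
  have sorted: "sorted (map (\<lambda>i. - \<bar>vec_index c i\<bar>) xs)" by (simp add: xs_def)
  define b where "b i = (if i < N then \<bar>vec_index c (xs ! i)\<bar> else 0)" for i
  have bij: "bij_betw ((!) xs) {..<N} {..<N}"
    by (rule bij_betw_nth[OF dist]) (simp_all add: len set)
  have inj: "inj_on ((!) xs) {..<N}" using bij by (rule bij_betw_imp_inj_on)
  define h where "h k = Matrix.vec N (\<lambda>i. if i \<in> (!) xs ` {..<min k N} then vec_index c i else 0)" for k
  have dim: "dim_vec (h k) = N" for k by (simp add: h_def)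
  have mem: "xs ! i \<in> (!) xs ` {..<min k N} \<longleftrightarrow> i < k" if "i < N" for i k
    using that by (auto dest: inj_onD[OF inj])
  have lt: "xs ! i < N" if "i < N" for i using bij that by (auto simp: bij_betw_def)
  have reindex: "(\<Sum>i<N. g i) = (\<Sum>i<N. g (xs ! i))" for g :: "nat \<Rightarrow> real"
    by (rule sum.reindex_bij_betw[OF bij, symmetric])
  show ?thesis
  proof
    show "0 \<le> b i" for i by (simp add: b_def)
    show "antimono b"
    proof (rule antimonoI)
      fix i j :: nat assume "i \<le> j"
      then show "b j \<le> b i"
        using sorted_nth_mono[OF sorted, of i j] len by (auto simp: b_def)
    qed
    show "b i = 0" if "N \<le> i" for i using that by (simp add: b_def)
    show "h k \<in> carrier_vec N" for k by (simp add: h_def)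
    show "nnz (h k) \<le> k" for k
    proof -
      have "nnz (h k) \<le> card ((!) xs ` {..<min k N})"
        unfolding nnz_def by (rule card_mono) (auto simp: h_def split: if_splits)
      also have "\<dots> \<le> k" using card_image_le[of "{..<min k N}" "(!) xs"] by simp
      finally show ?thesis .
    qed
    \<comment> \<open>Valid for every real \<open>s\<close>, because \<open>0 powr s = 0\<close>
      makes both the deleted entries and the padding vanish.\<close>
    show "psum s (h k) = (\<Sum>i<k. b i powr s)" for s k
    proof -
      have "psum s (h k) = (\<Sum>i<N. if i < k then b i powr s else 0)"
        unfolding psum_def dim
        by (subst reindex) (use lt mem in \<open>auto simp: h_def b_def intro!: sum.cong\<close>)
      also have "\<dots> = (\<Sum>i\<in>{..<N} \<inter> {..<k}. b i powr s)"
        by (subst sum.inter_restrict) auto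
      also have "\<dots> = (\<Sum>i<k. b i powr s)"
        by (rule sum.mono_neutral_left) (auto simp: b_def)
      finally show ?thesis .
    qed
    show "(enorm2 (c - h k))\<^sup>2 = (\<Sum>i\<in>{k..<N}. (b i)\<^sup>2)" for k
    proof -
      have "(enorm2 (c - h k))\<^sup>2 = (\<Sum>i<N. if k \<le> i then (b i)\<^sup>2 else 0)"
        unfolding enorm2_power2 index_minus_vec dim
        by (subst reindex) (use c lt mem in \<open>auto simp: h_def b_def intro!: sum.cong\<close>)
      also have "\<dots> = (\<Sum>i\<in>{..<N} \<inter> {k..}. (b i)\<^sup>2)"
        by (subst sum.inter_restrict) auto
      also have "{..<N} \<inter> {k..} = {k..<N}" by auto
      finally show ?thesis .
    qed
    show "psum s c = (\<Sum>i<N. b i powr s)" for s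
      unfolding psum_def carrier_vecD[OF c]
      by (subst reindex) (auto simp: b_def intro!: sum.cong)
  qed
qed


section \<open>Jackson and Bernstein inequalities\<close>

text \<open>Stechkin's estimate. The first \<open>k\<close> values are at least \<open>b k\<close>,
  so \<open>b k powr p\<close> is at most the total divided by \<open>k\<close>; in the tail one
  splits the square into the \<open>p\<close>-th power, which is summed, and the remaining power,
  which is bounded by that value.\<close>

lemma tail_sum_le:
  fixes b :: "nat \<Rightarrow> real"
  assumes b: "\<And>i. 0 \<le> b i" "antimono b" and k: "0 < k" and p: "0 < p" "p \<le> 2"
  shows "sqrt (\<Sum>i\<in>{k..<N}. (b i)\<^sup>2) \<le> real k powr - (1/p - 1/2) * (\<Sum>i<N. b i powr p) powr (1/p)"
proof (cases "k < N")
  case True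
  define M where "M = (\<Sum>i<N. b i powr p)"
  have mono: "b j powr p \<le> b i powr p" if "i \<le> j" for i j
    using b p antimonoD[OF b(2) that] by (intro powr_mono2) auto
  have M: "0 \<le> M" by (simp add: M_def sum_nonneg)
  have "real k * b k powr p = (\<Sum>i<k. b k powr p)" by simp
  also have "\<dots> \<le> (\<Sum>i<k. b i powr p)" by (intro sum_mono mono) auto
  also have "\<dots> \<le> M" unfolding M_def by (rule sum_mono2) (use True in auto)
  finally have bk: "b k powr p \<le> M / k" using k by (simp add: field_simps)
  have "(\<Sum>i\<in>{k..<N}. (b i)\<^sup>2) \<le> (\<Sum>i\<in>{k..<N}. b i powr p * (M / k) powr (2/p - 1))"
  proof (rule sum_mono)
    fix i assume i: "i \<in> {k..<N}"
    have "b i powr p \<le> M / k" using mono[of k i] bk i by auto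
    then have "(b i powr p) powr (2/p - 1) \<le> (M / k) powr (2/p - 1)"
      using p by (intro powr_mono2) auto
    then have "b i powr p * (b i powr p) powr (2/p - 1) \<le> b i powr p * (M / k) powr (2/p - 1)"
      by (rule mult_left_mono) simp
    moreover have "b i powr p * (b i powr p) powr (2/p - 1) = (b i)\<^sup>2"
      using p b by (simp add: powr_powr powr_add[symmetric] right_diff_distrib)
    ultimately show "(b i)\<^sup>2 \<le> b i powr p * (M / k) powr (2/p - 1)" by simp
  qed
  also have "\<dots> = (\<Sum>i\<in>{k..<N}. b i powr p) * (M / k) powr (2/p - 1)"
    by (rule sum_distrib_right[symmetric])
  also have "\<dots> \<le> M * (M / k) powr (2/p - 1)"
    unfolding M_def by (intro mult_right_mono sum_mono2) auto
  also have "\<dots> = M powr (2/p) * k powr - (2/p - 1)"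
    using M k by (cases "M = 0") (auto simp: powr_divide powr_diff powr_minus field_simps)
  finally have "sqrt (\<Sum>i\<in>{k..<N}. (b i)\<^sup>2) \<le> sqrt (M powr (2/p) * k powr - (2/p - 1))"
    by (rule real_sqrt_le_mono)
  also have "\<dots> = M powr (2/p * (1/2)) * k powr (- (2/p - 1) * (1/2))"
    using M by (simp add: powr_half_sqrt[symmetric] powr_mult powr_powr)
  also have "\<dots> = M powr (1/p) * k powr - (1/p - 1/2)"
    by (simp add: algebra_simps)
  finally show ?thesis by (simp add: M_def mult.commute)
qed simp

lemma powr_minus_half: "x powr (- 1 / 2) = 1 / sqrt x" if "0 < x" for x :: real
proof -
  have "x powr (- 1 / 2) = x powr - (1 / 2)" by simp
  also have "\<dots> = 1 / sqrt x" using that by (simp only: powr_minus_divide powr_half_sqrt order_less_imp_le)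
  finally show ?thesis .
qed

section \<open>Sparse sets and the error of best approximation\<close>

lemma sparsity_norm_le:
  assumes "c \<in> carrier_vec (dim_col \<Phi>)" "\<Phi> *\<^sub>v c = f"
  shows "sparsity_norm \<Phi> \<tau> f \<le> ennreal (lnorm \<tau> c)"
  unfolding sparsity_norm_def by (rule INF_lower) (use assms in auto)

lemma best_approx_le:
  assumes "y \<in> sparse_set \<Phi> k"
  shows "best_approx \<Phi> k f \<le> enorm2 (f - y)"
  unfolding best_approx_def by (rule cINF_lower) (use assms in \<open>auto intro!: bdd_belowI2[of _ 0]\<close>)

lemma zero_in_sparse_set: "0\<^sub>v (dim_row \<Phi>) \<in> sparse_set \<Phi> k"
proof -
  have "\<Phi> *\<^sub>v 0\<^sub>v (dim_col \<Phi>) = 0\<^sub>v (dim_row \<Phi>)" by (intro eq_vecI) auto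
  moreover have "nnz (0\<^sub>v (dim_col \<Phi>)) = 0" by (simp add: nnz_def)
  ultimately show ?thesis
    unfolding sparse_set_def by (intro CollectI exI[of _ "0\<^sub>v (dim_col \<Phi>)"]) auto
qed

lemma sparse_set_nonempty: "sparse_set \<Phi> k \<noteq> {}"
  using zero_in_sparse_set by blast

lemma sparse_set_mono: "k \<le> l \<Longrightarrow> sparse_set \<Phi> k \<subseteq> sparse_set \<Phi> l"
  unfolding sparse_set_def by fastforce

lemma sparse_set_carrier: "y \<in> sparse_set \<Phi> k \<Longrightarrow> y \<in> carrier_vec (dim_row \<Phi>)"
  unfolding sparse_set_def by (auto intro!: carrier_vecI)

lemma best_approx_nonneg: "0 \<le> best_approx \<Phi> k f"
  unfolding best_approx_def by (rule cINF_greatest) (auto simp: sparse_set_nonempty)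

lemma best_approx_antimono:
  assumes "k \<le> l"
  shows "best_approx \<Phi> l f \<le> best_approx \<Phi> k f"
  unfolding best_approx_def
  by (rule cINF_superset_mono[OF sparse_set_nonempty _ sparse_set_mono[OF assms]])
    (auto intro!: bdd_belowI2[of _ 0])

lemma best_approx_le_enorm2:
  assumes "f \<in> carrier_vec (dim_row \<Phi>)"
  shows "best_approx \<Phi> k f \<le> enorm2 f"
proof -
  have "f - 0\<^sub>v (dim_row \<Phi>) = f" using assms by auto
  then show ?thesis using best_approx_le[OF zero_in_sparse_set, of \<Phi> k f] by simp
qed

lemma best_approx_near:
  assumes "0 < \<epsilon>"
  obtains y where "y \<in> sparse_set \<Phi> k" "enorm2 (f - y) < best_approx \<Phi> k f + \<epsilon>"
proof -
  have "\<exists>y\<in>sparse_set \<Phi> k. enorm2 (f - y) < best_approx \<Phi> k f + \<epsilon>"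
    using assms unfolding best_approx_def
    by (subst cINF_less_iff[symmetric]) (auto simp: sparse_set_nonempty intro!: bdd_belowI2[of _ 0])
  then show ?thesis using that by blast
qed

lemma nnz_diff:
  assumes "c \<in> carrier_vec n" "d \<in> carrier_vec n"
  shows "nnz (c - d) \<le> nnz c + nnz d"
proof -
  have "nnz (c - d) \<le> card ({j. j < n \<and> vec_index c j \<noteq> 0} \<union> {j. j < n \<and> vec_index d j \<noteq> 0})"
    unfolding nnz_def using assms by (intro card_mono) auto
  also have "\<dots> \<le> nnz c + nnz d" unfolding nnz_def using assms card_Un_le by auto
  finally show ?thesis .
qed

lemma nnz_le: "c \<in> carrier_vec n \<Longrightarrow> nnz c \<le> n"
  unfolding nnz_def using card_mono[of "{..<n}" "{j. j < dim_vec c \<and> vec_index c j \<noteq> 0}"] by auto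

lemma sparse_set_diff:
  assumes "y \<in> sparse_set \<Phi> k" "z \<in> sparse_set \<Phi> l"
  shows "y - z \<in> sparse_set \<Phi> (k + l)"
proof -
  obtain c d where cd: "c \<in> carrier_vec (dim_col \<Phi>)" "y = \<Phi> *\<^sub>v c" "nnz c \<le> k"
      "d \<in> carrier_vec (dim_col \<Phi>)" "z = \<Phi> *\<^sub>v d" "nnz d \<le> l"
    using assms by (auto simp: sparse_set_def)
  then have "y - z = \<Phi> *\<^sub>v (c - d)"
    using mult_minus_distrib_mat_vec[of \<Phi> "dim_row \<Phi>" "dim_col \<Phi>" c d] by auto
  moreover have "nnz (c - d) \<le> k + l" using nnz_diff[of c "dim_col \<Phi>" d] cd by simp
  ultimately show ?thesis unfolding sparse_set_def using cd by (auto intro!: exI[of _ "c - d"])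
qed

section \<open>Frames with the lower restricted isometry property\<close>

definition bernstein_const :: "real \<Rightarrow> real \<Rightarrow> real \<Rightarrow> real \<Rightarrow> real" where
  "bernstein_const A \<delta> \<kappa> \<tau> = max ((1 - \<delta>) powr (- 1 / 2)) (A powr (- 1 / 2) * \<kappa> powr (1 / 2 - 1 / \<tau>))"

text \<open>The dimensions and the matrix are parameters of the predicate too, so that
  \<open>\<forall>m N \<Phi>. lrip_frame m N \<Phi> A B \<delta> \<kappa>\<close> can stand behind a
  constant depending on the other four only.\<close>

locale lrip_frame =
  fixes m N :: nat and \<Phi> :: "real mat" and A B \<delta> \<kappa> :: real
  assumes carrier: "\<Phi> \<in> carrier_mat m N"
    and frame: "frame_bounds \<Phi> A B" and lrip: "LRIP \<Phi> (\<kappa> * real N) \<delta>"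
    and A_pos: "0 < A" and A_le_B: "A \<le> B" and delta: "\<delta> < 1" and kappa: "0 < \<kappa>"
begin

lemma dims [simp]: "dim_row \<Phi> = m" "dim_col \<Phi> = N"
  using carrier by auto

lemma mult_carrier [simp]: "\<Phi> *\<^sub>v c \<in> carrier_vec m"
  by (simp add: carrier_vecI)

lemma enorm2_transpose_le:
  assumes "f \<in> carrier_vec m"
  shows "enorm2 (transpose_mat \<Phi> *\<^sub>v f) \<le> sqrt B * enorm2 f"
  using frame assms real_sqrt_le_mono[of "(enorm2 (transpose_mat \<Phi> *\<^sub>v f))\<^sup>2" "B * (enorm2 f)\<^sup>2"]
  by (auto simp: frame_bounds_def real_sqrt_mult)

text \<open>Duality: the frame bound concerns the transpose, so the square of the norm is moved
  there as a scalar product and one factor is cancelled.\<close>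

lemma enorm2_mult_le:
  assumes "c \<in> carrier_vec N"
  shows "enorm2 (\<Phi> *\<^sub>v c) \<le> sqrt B * enorm2 c"
proof (cases "enorm2 (\<Phi> *\<^sub>v c) = 0")
  case True
  then show ?thesis using A_pos A_le_B by simp
next
  case False
  let ?f = "\<Phi> *\<^sub>v c"
  have "(enorm2 ?f)\<^sup>2 = scalar_prod (transpose_mat \<Phi> *\<^sub>v ?f) c"
    unfolding enorm2_power2_scalar_prod using transpose_vec_mult_scalar[OF carrier assms, of ?f] by simp
  also have "\<dots> \<le> enorm2 (transpose_mat \<Phi> *\<^sub>v ?f) * enorm2 c"
    by (rule scalar_prod_le_enorm2[OF _ assms]) (use carrier in auto)
  also have "\<dots> \<le> sqrt B * enorm2 ?f * enorm2 c"
    by (intro mult_right_mono enorm2_transpose_le) auto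
  finally have "enorm2 ?f * enorm2 ?f \<le> enorm2 ?f * (sqrt B * enorm2 c)"
    by (simp add: power2_eq_square mult_ac)
  moreover have "0 < enorm2 ?f" using False enorm2_nonneg[of ?f] by linarith
  ultimately show ?thesis by (simp only: mult_le_cancel_left_pos)
qed

lemma dual_coefficients:
  assumes f: "f \<in> carrier_vec m"
  obtains c where "c \<in> carrier_vec N" "\<Phi> *\<^sub>v c = f" "enorm2 c \<le> A powr (- 1 / 2) * enorm2 f"
proof -
  \<comment> \<open>the frame operator; the coefficients are those of the canonical dual frame\<close>
  define S where "S = \<Phi> * transpose_mat \<Phi>"
  have S: "S \<in> carrier_mat m m" using carrier by (simp add: S_def)
  have S_eq: "S *\<^sub>v g = \<Phi> *\<^sub>v (transpose_mat \<Phi> *\<^sub>v g)" if "g \<in> carrier_vec m" for g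
    unfolding S_def using carrier that by (simp add: assoc_mult_mat_vec[of _ m N _ m])
  have tc: "transpose_mat \<Phi> *\<^sub>v g \<in> carrier_vec N" for g
    by (rule carrier_vecI) simp
  have quad: "(enorm2 (transpose_mat \<Phi> *\<^sub>v g))\<^sup>2 = scalar_prod g (S *\<^sub>v g)" if "g \<in> carrier_vec m" for g
    unfolding enorm2_power2_scalar_prod S_eq[OF that]
    using transpose_vec_mult_scalar[OF carrier tc that, of g] by simp
  have lower: "A * (enorm2 g)\<^sup>2 \<le> (enorm2 (transpose_mat \<Phi> *\<^sub>v g))\<^sup>2" if "g \<in> carrier_vec m" for g
    using frame that by (auto simp: frame_bounds_def)
  have "det S \<noteq> 0"
  proof
    assume "det S = 0"
    then obtain v where v: "v \<in> carrier_vec m" "v \<noteq> 0\<^sub>v m" "S *\<^sub>v v = 0\<^sub>v m"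
      using det_0_iff_vec_prod_zero[OF S] by auto
    then have "A * (enorm2 v)\<^sup>2 \<le> 0" using lower[of v] quad[of v] by simp
    then have "enorm2 v = 0" using A_pos by (simp add: mult_le_0_iff)
    then show False using enorm2_eq_0_iff v by auto
  qed
  then have "S \<in> Units (ring_mat TYPE(real) m ())" by (rule det_non_zero_imp_unit[OF S])
  then obtain R where R: "R \<in> carrier_mat m m" "S * R = 1\<^sub>m m"
    by (auto simp: Units_def ring_mat_def)
  define g where "g = R *\<^sub>v f"
  have g: "g \<in> carrier_vec m" using R f by (simp add: g_def)
  have Sg: "S *\<^sub>v g = f"
    unfolding g_def using assoc_mult_mat_vec[OF S R(1) f] R f by simp
  define c where "c = transpose_mat \<Phi> *\<^sub>v g"
  show ?thesis
  proof (rule that[of c])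
    show "c \<in> carrier_vec N" "\<Phi> *\<^sub>v c = f" using tc S_eq[OF g] Sg by (auto simp: c_def)
    \<comment> \<open>The square is the scalar product of \<open>g\<close> with
      \<open>S g = f\<close>. The lower frame bound then replaces the norm of \<open>g\<close> by
      that of \<open>c\<close> over \<open>sqrt A\<close>, and cancelling gives the factor
      \<open>A powr (- 1 / 2)\<close>; estimating \<open>R\<close> and the transpose separately
      would give \<open>sqrt B / A\<close>.\<close>
    have le: "(enorm2 c)\<^sup>2 \<le> enorm2 g * enorm2 f"
      using quad[OF g] scalar_prod_le_enorm2[OF g f] by (simp add: c_def Sg)
    have "sqrt (A * (enorm2 g)\<^sup>2) \<le> sqrt ((enorm2 c)\<^sup>2)"
      using lower[OF g] by (intro real_sqrt_le_mono) (simp add: c_def)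
    then have "enorm2 g \<le> enorm2 c / sqrt A"
      using A_pos by (simp add: real_sqrt_mult field_simps)
    then have "enorm2 c * enorm2 c \<le> enorm2 c / sqrt A * enorm2 f"
      using le mult_right_mono[of "enorm2 g" "enorm2 c / sqrt A" "enorm2 f"]
      by (simp add: power2_eq_square)
    then have *: "enorm2 c * enorm2 c \<le> enorm2 c * (enorm2 f / sqrt A)" by simp
    have "enorm2 c \<le> enorm2 f / sqrt A"
    proof (cases "enorm2 c = 0")
      case False
      then have "0 < enorm2 c" using enorm2_nonneg[of c] by linarith
      then show ?thesis using * by (simp only: mult_le_cancel_left_pos)
    qed (use A_pos in simp)
    then show "enorm2 c \<le> A powr (- 1 / 2) * enorm2 f"
      using A_pos by (simp only: powr_minus_half) simp
  qed
qed

text \<open>Coefficients are produced instead of a bound for the infimum, because telescoping adds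
  them entry by entry.\<close>

lemma bernstein_coefficients:
  assumes f: "f \<in> sparse_set \<Phi> k" and k: "1 \<le> k" and \<tau>: "0 < \<tau>" "\<tau> \<le> 2"
  obtains c where "c \<in> carrier_vec N" "\<Phi> *\<^sub>v c = f"
    "lnorm \<tau> c \<le> bernstein_const A \<delta> \<kappa> \<tau> * real k powr (1/\<tau> - 1/2) * enorm2 f"
proof (cases "real k \<le> \<kappa> * real N")
  case True
  obtain c where c: "c \<in> carrier_vec N" "\<Phi> *\<^sub>v c = f" "nnz c \<le> k"
    using f by (auto simp: sparse_set_def)
  have "(1 - \<delta>) * (enorm2 c)\<^sup>2 \<le> (enorm2 f)\<^sup>2"
    using lrip c True by (auto simp: LRIP_def)
  then have "sqrt ((1 - \<delta>) * (enorm2 c)\<^sup>2) \<le> sqrt ((enorm2 f)\<^sup>2)" by (rule real_sqrt_le_mono)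
  then have "enorm2 c \<le> enorm2 f / sqrt (1 - \<delta>)"
    using delta by (simp add: real_sqrt_mult pos_le_divide_eq mult.commute)
  then have "enorm2 c \<le> (1 - \<delta>) powr (- 1 / 2) * enorm2 f"
    using delta by (simp only: powr_minus_half) simp
  also have "\<dots> \<le> bernstein_const A \<delta> \<kappa> \<tau> * enorm2 f"
    by (intro mult_right_mono) (auto simp: bernstein_const_def)
  finally have "real k powr (1/\<tau> - 1/2) * enorm2 c \<le> real k powr (1/\<tau> - 1/2) * (bernstein_const A \<delta> \<kappa> \<tau> * enorm2 f)"
    by (intro mult_left_mono) auto
  then show ?thesis
    using lnorm_le_enorm2[OF c(3) \<tau>] by (intro that[OF c(1,2)]) (simp add: mult_ac)
next
  case False
  obtain c where c: "c \<in> carrier_vec N" "\<Phi> *\<^sub>v c = f" "enorm2 c \<le> A powr (- 1 / 2) * enorm2 f"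
    using dual_coefficients[of f] sparse_set_carrier[OF f, unfolded dims] by blast
  \<comment> \<open>The dual coefficients need not be sparse, so Hoelder costs a power of
    \<open>N\<close>. Here \<open>N < k / \<kappa>\<close> trades it for a power of
    \<open>k\<close>, which is where the power of \<open>\<kappa>\<close> in the constant comes
    from.\<close>
  have "real N powr (1/\<tau> - 1/2) \<le> (real k / \<kappa>) powr (1/\<tau> - 1/2)"
    using False \<tau> kappa by (intro powr_mono2) (auto simp: field_simps)
  also have "\<dots> = real k powr (1/\<tau> - 1/2) * \<kappa> powr (1/2 - 1/\<tau>)"
    using kappa powr_minus_divide[of \<kappa> "1/\<tau> - 1/2"] by (simp add: powr_divide)
  finally have "real N powr (1/\<tau> - 1/2) * enorm2 c
      \<le> (real k powr (1/\<tau> - 1/2) * \<kappa> powr (1/2 - 1/\<tau>)) * (A powr (- 1 / 2) * enorm2 f)"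
    using c(3) by (intro mult_mono) auto
  also have "\<dots> = (A powr (- 1 / 2) * \<kappa> powr (1/2 - 1/\<tau>)) * (real k powr (1/\<tau> - 1/2) * enorm2 f)"
    by simp
  also have "\<dots> \<le> bernstein_const A \<delta> \<kappa> \<tau> * (real k powr (1/\<tau> - 1/2) * enorm2 f)"
    by (intro mult_right_mono) (auto simp: bernstein_const_def)
  finally show ?thesis
    using lnorm_le_enorm2[OF nnz_le[OF c(1)] \<tau>] by (intro that[OF c(1,2)]) (simp add: mult_ac)
qed

lemma sparsity_space_eq: "sparsity_space \<Phi> \<tau> = carrier_vec m"
proof -
  have "sparsity_norm \<Phi> \<tau> f < \<infinity>" if f: "f \<in> carrier_vec m" for f
  proof -
    obtain c where "c \<in> carrier_vec N" "\<Phi> *\<^sub>v c = f" using dual_coefficients[OF f] by blast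
    then have "sparsity_norm \<Phi> \<tau> f \<le> ennreal (lnorm \<tau> c)" by (intro sparsity_norm_le) auto
    then show ?thesis using ennreal_less_top order.strict_trans1 unfolding infinity_ennreal_def by blast
  qed
  then show ?thesis by (auto simp: sparsity_space_def)
qed

text \<open>This lets the dyadic telescoping end at \<open>f\<close> itself after finitely many
  steps.\<close>

lemma sparse_set_eq_carrier:
  assumes "N \<le> k"
  shows "sparse_set \<Phi> k = carrier_vec m"
proof (intro equalityI subsetI)
  fix f :: "real Matrix.vec" assume "f \<in> carrier_vec m"
  then obtain c where "c \<in> carrier_vec N" "\<Phi> *\<^sub>v c = f" using dual_coefficients by blast
  moreover have "nnz c \<le> k" using nnz_le calculation(1) assms order_trans by blast
  ultimately show "f \<in> sparse_set \<Phi> k" by (auto simp: sparse_set_def)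
qed (use sparse_set_carrier in fastforce)

text \<open>Keeping the \<open>k\<close> largest coefficients leaves a tail controlled by Stechkin's
  estimate; the upper frame bound carries it over to the vectors.\<close>

lemma jackson:
  assumes c: "c \<in> carrier_vec N" and k: "0 < k" and p: "0 < p" "p \<le> 2"
  shows "best_approx \<Phi> k (\<Phi> *\<^sub>v c) \<le> sqrt B * real k powr - (1/p - 1/2) * lnorm p c"
proof -
  obtain b h where b: "\<And>i. 0 \<le> b i" "antimono b" and "\<And>i. N \<le> i \<Longrightarrow> b i = 0"
    and h: "\<And>k. h k \<in> carrier_vec N" "\<And>k. nnz (h k) \<le> k"
    and "\<And>k s. psum s (h k) = (\<Sum>i<k. b i powr s)"
    and tail: "\<And>k. (enorm2 (c - h k))\<^sup>2 = (\<Sum>i\<in>{k..<N}. (b i)\<^sup>2)"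
    and psum: "\<And>s. psum s c = (\<Sum>i<N. b i powr s)"
    by (rule decreasing_rearrangement[OF c]) (rule that)
  have "best_approx \<Phi> k (\<Phi> *\<^sub>v c) \<le> enorm2 (\<Phi> *\<^sub>v c - \<Phi> *\<^sub>v h k)"
    by (rule best_approx_le) (use h in \<open>auto simp: sparse_set_def\<close>)
  also have "\<Phi> *\<^sub>v c - \<Phi> *\<^sub>v h k = \<Phi> *\<^sub>v (c - h k)"
    using mult_minus_distrib_mat_vec[OF carrier c h(1)] by simp
  also have "enorm2 \<dots> \<le> sqrt B * enorm2 (c - h k)"
    using c h by (intro enorm2_mult_le) auto
  also have "enorm2 (c - h k) = sqrt (\<Sum>i\<in>{k..<N}. (b i)\<^sup>2)" by (simp flip: tail)
  also have "sqrt B * \<dots> \<le> sqrt B * (real k powr - (1/p - 1/2) * lnorm p c)"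
    unfolding lnorm_psum psum using A_pos A_le_B by (intro mult_left_mono tail_sum_le b k p) auto
  finally show ?thesis by (simp add: mult_ac)
qed

end


section \<open>Sparsity norm and approximation norm\<close>

lemma epowr_ennreal: "0 \<le> x \<Longrightarrow> epowr (ennreal x) a = ennreal (x powr a)"
  by (simp add: epowr_def)

lemma epowr_top: "epowr \<infinity> a = \<infinity>"
  by (simp add: epowr_def)

lemma epowr_mono:
  assumes "x \<le> y" "0 \<le> a"
  shows "epowr x a \<le> epowr y a"
proof (cases y)
  case (real v)
  then obtain u where "x = ennreal u" "0 \<le> u"
    using assms(1) by (cases x) (auto simp: top_unique)
  then show ?thesis using assms real by (simp add: epowr_ennreal powr_mono2)
qed (simp add: epowr_def)

lemma psum_lnorm: "0 < s \<Longrightarrow> psum s c = lnorm s c powr s"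
  by (simp add: lnorm_psum powr_powr)

lemma psum_zero [simp]: "psum s (0\<^sub>v n) = 0"
  by (simp add: psum_def)

lemma lnorm_nonneg [simp]: "0 \<le> lnorm s c"
  by (simp add: lnorm_psum)

text \<open>A positive finite factor is invertible in \<open>ennreal\<close>, so it can be moved
  past the infimum, even an empty one.\<close>

lemma ennreal_le_cmult_INF:
  fixes x :: ennreal
  assumes a: "0 < a" and le: "\<And>i. i \<in> I \<Longrightarrow> x \<le> ennreal a * y i"
  shows "x \<le> ennreal a * (INF i\<in>I. y i)"
proof -
  have inv: "ennreal (1 / a) * (ennreal a * z) = z" "ennreal a * (ennreal (1 / a) * z) = z" for z
    using a by (simp_all add: mult.assoc[symmetric] ennreal_mult[symmetric])
  have "ennreal (1 / a) * x \<le> (INF i\<in>I. y i)"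
  proof (rule INF_greatest)
    fix i assume "i \<in> I"
    then show "ennreal (1 / a) * x \<le> y i"
      using mult_left_mono[OF le, of i "ennreal (1 / a)"] inv by simp
  qed
  then show ?thesis using mult_left_mono[of "ennreal (1 / a) * x" _ "ennreal a"] inv by simp
qed

definition approx_term :: "real mat \<Rightarrow> real \<Rightarrow> real \<Rightarrow> real Matrix.vec \<Rightarrow> nat \<Rightarrow> real" where
  "approx_term \<Phi> s q f k = (real k powr s * best_approx \<Phi> k f) powr q / real k"

lemma approx_term_nonneg [simp]: "0 \<le> approx_term \<Phi> s q f k"
  by (simp add: approx_term_def)

text \<open>The condition \<open>s * q \<le> 1\<close> makes the exponent of \<open>k\<close>
  nonpositive. It is satisfied by \<open>r\<close> and \<open>\<tau>\<close>, since r \<tau> = 1 -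
  \<tau>/2.\<close>

lemma approx_term_antimono:
  assumes "0 < q" "s * q \<le> 1" "0 < i" "i \<le> j"
  shows "approx_term \<Phi> s q f j \<le> approx_term \<Phi> s q f i"
proof -
  have eq: "approx_term \<Phi> s q f k = real k powr (s * q - 1) * best_approx \<Phi> k f powr q" if "0 < k" for k
    using that by (simp add: approx_term_def powr_mult powr_powr powr_diff)
  have "real j powr (s * q - 1) \<le> real i powr (s * q - 1)"
    using assms by (intro powr_mono2') auto
  moreover have "best_approx \<Phi> j f powr q \<le> best_approx \<Phi> i f powr q"
    using assms by (intro powr_mono2 best_approx_antimono best_approx_nonneg) auto
  ultimately show ?thesis using assms by (simp add: eq mult_mono)
qed

lemma approx_term_two_pow:
  "2 ^ l * approx_term \<Phi> s q f (2 ^ l) = (2 powr (s * q)) ^ l * best_approx \<Phi> (2 ^ l) f powr q"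
  by (simp add: approx_term_def powr_mult powr_pow powr_powr)

lemma approx_norm_alt:
  "approx_norm \<Phi> s q f = ennreal (enorm2 f) + epowr (\<Sum>i. ennreal (approx_term \<Phi> s q f (Suc i))) (1 / q)"
  by (simp add: approx_norm_def approx_seminorm_def approx_term_def)

lemma dyadic_approx_le:
  assumes "0 < q" "s * q \<le> 1"
  shows "ennreal (\<Sum>l<L. (2 powr (s * q)) ^ l * best_approx \<Phi> (2 ^ l) f powr q)
    \<le> 2 * (\<Sum>i. ennreal (approx_term \<Phi> s q f (Suc i)))"
proof -
  have "(\<Sum>l<L. (2 powr (s * q)) ^ l * best_approx \<Phi> (2 ^ l) f powr q)
      \<le> (\<Sum>l\<le>L. 2 ^ l * approx_term \<Phi> s q f (2 ^ l))"
    unfolding approx_term_two_pow by (rule sum_mono2) auto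
  also have "\<dots> \<le> 2 * (\<Sum>i\<in>{1..2^L}. approx_term \<Phi> s q f i)"
    by (rule dyadic_condensation_ge) (use assms approx_term_antimono in auto)
  also have "(\<Sum>i\<in>{1..2^L}. approx_term \<Phi> s q f i) = (\<Sum>i<2^L. approx_term \<Phi> s q f (Suc i))"
    by (simp add: sum.atLeast1_atMost_eq)
  finally have "ennreal (\<Sum>l<L. (2 powr (s * q)) ^ l * best_approx \<Phi> (2 ^ l) f powr q)
      \<le> ennreal (2 * (\<Sum>i<2^L. approx_term \<Phi> s q f (Suc i)))"
    by (rule ennreal_leI)
  also have "\<dots> = 2 * (\<Sum>i<2^L. ennreal (approx_term \<Phi> s q f (Suc i)))"
    by (simp add: ennreal_mult sum_nonneg sum_ennreal)
  also have "\<dots> \<le> 2 * (\<Sum>i. ennreal (approx_term \<Phi> s q f (Suc i)))"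
    by (intro mult_left_mono sum_le_suminf) auto
  finally show ?thesis .
qed

lemma suminf_approx_term_le:
  assumes "0 < q" "s * q \<le> 1"
    and "\<And>L. (\<Sum>l<L. (2 powr (s * q)) ^ l * best_approx \<Phi> (2 ^ l) f powr q) \<le> X"
  shows "(\<Sum>i. ennreal (approx_term \<Phi> s q f (Suc i))) \<le> ennreal X"
proof (rule suminf_le_const)
  fix n
  have "(\<Sum>i<n. approx_term \<Phi> s q f (Suc i)) = (\<Sum>i\<in>{1..n}. approx_term \<Phi> s q f i)"
    by (simp add: sum.atLeast1_atMost_eq)
  also have "\<dots> \<le> (\<Sum>i\<in>{1..<2^n}. approx_term \<Phi> s q f i)"
    by (rule sum_mono2) (auto intro: order.strict_trans1[OF _ less_exp])
  also have "\<dots> \<le> (\<Sum>l<n. 2 ^ l * approx_term \<Phi> s q f (2 ^ l))"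
    by (rule dyadic_condensation_le) (use assms approx_term_antimono in auto)
  also have "\<dots> \<le> X" unfolding approx_term_two_pow by (rule assms)
  finally show "(\<Sum>i<n. ennreal (approx_term \<Phi> s q f (Suc i))) \<le> ennreal X"
    by (simp add: sum_ennreal ennreal_leI)
qed simp

context lrip_frame
begin

text \<open>For \<open>\<tau> \<le> 1\<close> the \<open>\<tau>\<close>-th power of the quasi-norm is subadditive, so the Bernstein inequality can be
  applied to each difference, which lies in \<open>sparse_set \<Phi> (2 ^ (j + 2))\<close>; this is where the factor
  \<open>4 powr (r * \<tau>)\<close> comes from.\<close>

lemma telescoping_coefficients:
  assumes \<tau>: "0 < \<tau>" "\<tau> \<le> 1" and r: "r = 1/\<tau> - 1/2" and y: "\<And>j. y j \<in> sparse_set \<Phi> (2 ^ j)"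
  shows "\<exists>c\<in>carrier_vec N. \<Phi> *\<^sub>v c = y J \<and> psum \<tau> c \<le> bernstein_const A \<delta> \<kappa> \<tau> powr \<tau> *
    (enorm2 (y 0) powr \<tau> + (\<Sum>j<J. 4 powr (r * \<tau>) * ((2 powr (r * \<tau>)) ^ j * enorm2 (y (Suc j) - y j) powr \<tau>)))"
proof -
  let ?D = "bernstein_const A \<delta> \<kappa> \<tau>"
  have D: "0 \<le> ?D" by (simp add: bernstein_const_def le_max_iff_disj)
  have bern: "\<exists>c\<in>carrier_vec N. \<Phi> *\<^sub>v c = z \<and>
      psum \<tau> c \<le> ?D powr \<tau> * ((2 powr (r * \<tau>)) ^ j * enorm2 z powr \<tau>)"
    if z: "z \<in> sparse_set \<Phi> (2 ^ j)" for z j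
  proof -
    obtain c where c: "c \<in> carrier_vec N" "\<Phi> *\<^sub>v c = z"
        and le: "lnorm \<tau> c \<le> ?D * real (2 ^ j) powr r * enorm2 z"
      using bernstein_coefficients[OF z, of \<tau>] \<tau> unfolding r by auto
    have "psum \<tau> c \<le> (?D * real (2 ^ j) powr r * enorm2 z) powr \<tau>"
      unfolding psum_lnorm[OF \<tau>(1)] using le \<tau> by (intro powr_mono2) auto
    also have "\<dots> = ?D powr \<tau> * ((2 powr (r * \<tau>)) ^ j * enorm2 z powr \<tau>)"
      using D by (simp add: powr_mult powr_pow powr_powr)
    finally show ?thesis using c by blast
  qed
  show ?thesis
  proof (induction J)
    case 0
    then show ?case using bern[OF y[of 0]] by simp
  next
    case (Suc J)
    then obtain c where c: "c \<in> carrier_vec N" "\<Phi> *\<^sub>v c = y J"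
      "psum \<tau> c \<le> ?D powr \<tau> * (enorm2 (y 0) powr \<tau> +
        (\<Sum>j<J. 4 powr (r * \<tau>) * ((2 powr (r * \<tau>)) ^ j * enorm2 (y (Suc j) - y j) powr \<tau>)))"
      by blast
    have "y (Suc J) - y J \<in> sparse_set \<Phi> (2 ^ Suc J + 2 ^ J)" by (intro sparse_set_diff y)
    then have "y (Suc J) - y J \<in> sparse_set \<Phi> (2 ^ (J + 2))"
      using sparse_set_mono[of "2 ^ Suc J + 2 ^ J" "2 ^ (J + 2)" \<Phi>] by auto
    then obtain d where d: "d \<in> carrier_vec N" "\<Phi> *\<^sub>v d = y (Suc J) - y J"
      "psum \<tau> d \<le> ?D powr \<tau> * ((2 powr (r * \<tau>)) ^ (J + 2) * enorm2 (y (Suc J) - y J) powr \<tau>)"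
      using bern by blast
    have "(4::real) powr (r * \<tau>) = (2 powr (r * \<tau>))\<^sup>2"
      by (simp add: powr_pow[symmetric])
    then have four: "(2 powr (r * \<tau>)) ^ (J + 2) = 4 powr (r * \<tau>) * (2 powr (r * \<tau>)) ^ J"
      by (simp add: power_add power2_eq_square)
    have yc: "y j \<in> carrier_vec m" for j using sparse_set_carrier[OF y[of j]] by simp
    have "\<Phi> *\<^sub>v (c + d) = y J + (y (Suc J) - y J)"
      using mult_add_distrib_mat_vec[OF carrier c(1) d(1)] c d by simp
    also have "\<dots> = y (Suc J)" using yc[of J] yc[of "Suc J"] by (intro eq_vecI) auto
    finally have "\<Phi> *\<^sub>v (c + d) = y (Suc J)" .
    moreover have "psum \<tau> (c + d) \<le> psum \<tau> c + psum \<tau> d"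
      using c d \<tau> by (intro psum_add) auto
    moreover have "psum \<tau> c + psum \<tau> d \<le> ?D powr \<tau> * (enorm2 (y 0) powr \<tau> +
        (\<Sum>j<Suc J. 4 powr (r * \<tau>) * ((2 powr (r * \<tau>)) ^ j * enorm2 (y (Suc j) - y j) powr \<tau>)))"
      using add_mono[OF c(3) d(3)[unfolded four]] by (simp add: distrib_left mult.assoc add.assoc)
    ultimately show ?case
      using c d by (intro bexI[of _ "c + d"]) auto
  qed
qed

text \<open>\<open>J\<close> is only large enough for the telescoping to reach \<open>f\<close> and
  does not enter the constant. There, \<open>2 powr \<tau>\<close> stands for the two errors in each
  difference, and the fraction is the sum of the geometric series left by the additive
  errors.\<close>

lemma coefficients_le_dyadic:
  assumes \<tau>: "0 < \<tau>" "\<tau> \<le> 1" and r: "r = 1/\<tau> - 1/2" and f: "f \<in> carrier_vec m" and J: "N \<le> 2 ^ J"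
  shows "\<exists>c\<in>carrier_vec N. \<Phi> *\<^sub>v c = f \<and> psum \<tau> c \<le> bernstein_const A \<delta> \<kappa> \<tau> powr \<tau> *
      (3 powr \<tau> + 4 powr (r * \<tau>) * 2 powr \<tau> * (1 + 1 / (1 - 2 powr - (r * \<tau>)))) *
    (enorm2 f powr \<tau> + (\<Sum>j<J. (2 powr (r * \<tau>)) ^ j * best_approx \<Phi> (2 ^ j) f powr \<tau>))"
    (is "\<exists>c\<in>_. _ \<and> _ \<le> ?D * ?K * (_ + ?S)")
\<comment> \<open>The additive errors are multiples of the norm of \<open>f\<close> and have to be
  positive, so \<open>f = 0\<close> is treated apart.\<close>
proof (cases "f = 0\<^sub>v m")
  case True
  have "\<Phi> *\<^sub>v 0\<^sub>v N = 0\<^sub>v m" using carrier by (intro eq_vecI) auto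
  moreover have "2 powr - (r * \<tau>) < 1" using \<tau> r by (intro powr_less_one) (auto simp: field_simps)
  ultimately show ?thesis
    using True by (intro bexI[of _ "0\<^sub>v N"]) (auto intro!: mult_nonneg_nonneg add_nonneg_nonneg sum_nonneg)
next
  case False
  define e where "e = enorm2 f"
  have e: "0 < e" using False enorm2_eq_0_iff[OF f] enorm2_nonneg[of f] by (auto simp: e_def order_less_le)
  define v where "v = 2 powr - (r * \<tau>)"
  have rpos: "0 < r" using \<tau> by (simp add: r field_simps)
  have v: "0 < v" "v < 1" using rpos \<tau> by (auto simp: v_def powr_less_one)
  \<comment> \<open>The infimum \<open>best_approx\<close> may be 0, so a relative error does not suffice; this additive error
    decays fast enough to be summable against the weights \<open>2 powr (r * \<tau> * j)\<close>.\<close>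
  define \<epsilon> where "\<epsilon> j = e * (4 powr - r) ^ j" for j :: nat
  have eps: "0 < \<epsilon> j" for j using e by (simp add: \<epsilon>_def)
  have eps_dec: "\<epsilon> (Suc j) \<le> \<epsilon> j" for j
  proof -
    have "\<epsilon> (Suc j) = (4 powr - r) * \<epsilon> j" by (simp add: \<epsilon>_def)
    also have "\<dots> \<le> 1 * \<epsilon> j" using eps[of j] rpos by (intro mult_right_mono) (auto simp: powr_le_one_le intro!: less_imp_le powr_less_one)
    finally show ?thesis by simp
  qed
  have "\<exists>y. y \<in> sparse_set \<Phi> (2 ^ j) \<and> enorm2 (f - y) \<le> best_approx \<Phi> (2 ^ j) f + \<epsilon> j \<and> (J \<le> j \<longrightarrow> y = f)" for j
  proof (cases "J \<le> j")
    case True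
    then have "(2::nat) ^ J \<le> 2 ^ j" by simp
    then have "N \<le> 2 ^ j" using J by (rule order_trans[rotated])
    then show ?thesis
      using True f sparse_set_eq_carrier[of "2 ^ j"] best_approx_nonneg[of \<Phi> "2 ^ j" f] eps[of j]
      by (intro exI[of _ f]) (simp add: add_nonneg_nonneg less_imp_le)
  next
    case False
    then show ?thesis using best_approx_near[OF eps[of j], of \<Phi> "2 ^ j" f] by (metis less_imp_le)
  qed
  then obtain y where y: "\<And>j. y j \<in> sparse_set \<Phi> (2 ^ j)"
      "\<And>j. enorm2 (f - y j) \<le> best_approx \<Phi> (2 ^ j) f + \<epsilon> j" "\<And>j. J \<le> j \<Longrightarrow> y j = f"
    by metis
  have yc: "y j \<in> carrier_vec m" for j using sparse_set_carrier[OF y(1)[of j]] by simp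
  obtain c where c: "c \<in> carrier_vec N" "\<Phi> *\<^sub>v c = y J" and
    pc: "psum \<tau> c \<le> ?D * (enorm2 (y 0) powr \<tau> +
      (\<Sum>j<J. 4 powr (r * \<tau>) * ((2 powr (r * \<tau>)) ^ j * enorm2 (y (Suc j) - y j) powr \<tau>)))"
    using telescoping_coefficients[OF \<tau> r y(1), of J] by blast
  \<comment> \<open>One \<open>e\<close> comes from \<open>f\<close> and two from the error of
    \<open>y 0\<close>, as both \<open>best_approx \<Phi> 1 f\<close> and
    \<open>\<epsilon> 0\<close> are at most \<open>e\<close>.\<close>
  have y0: "enorm2 (y 0) powr \<tau> \<le> 3 powr \<tau> * e powr \<tau>"
  proof -
    have "enorm2 (y 0) \<le> enorm2 (y 0 - f) + enorm2 f"
      using enorm2_triangle[OF yc f zero_carrier_vec, of 0] yc[of 0] f by simp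
    also have "enorm2 (y 0 - f) = enorm2 (f - y 0)" by (rule enorm2_diff_commute[OF yc f])
    also have "enorm2 (f - y 0) \<le> e + e"
      using y(2)[of 0] best_approx_le_enorm2[of f \<Phi> 1] f by (simp add: \<epsilon>_def e_def)
    finally have "enorm2 (y 0) powr \<tau> \<le> (3 * e) powr \<tau>"
      using \<tau> by (intro powr_mono2) (auto simp: e_def)
    then show ?thesis using e by (simp add: powr_mult)
  qed
  have step: "(2 powr (r * \<tau>)) ^ j * enorm2 (y (Suc j) - y j) powr \<tau>
      \<le> 2 powr \<tau> * ((2 powr (r * \<tau>)) ^ j * best_approx \<Phi> (2 ^ j) f powr \<tau> + e powr \<tau> * v ^ j)" for j
  proof -
    have "enorm2 (y (Suc j) - y j) \<le> enorm2 (y (Suc j) - f) + enorm2 (f - y j)"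
      by (rule enorm2_triangle[OF yc f yc])
    also have "enorm2 (y (Suc j) - f) = enorm2 (f - y (Suc j))" by (rule enorm2_diff_commute[OF yc f])
    also have "\<dots> \<le> best_approx \<Phi> (2 ^ j) f + \<epsilon> j"
      using y(2)[of "Suc j"] eps_dec[of j] best_approx_antimono[of "2 ^ j" "2 ^ Suc j" \<Phi> f] by simp
    finally have "enorm2 (y (Suc j) - y j) \<le> 2 * (best_approx \<Phi> (2 ^ j) f + \<epsilon> j)"
      using y(2)[of j] by simp
    then have "enorm2 (y (Suc j) - y j) powr \<tau> \<le> (2 * (best_approx \<Phi> (2 ^ j) f + \<epsilon> j)) powr \<tau>"
      using \<tau> by (intro powr_mono2) auto
    also have "\<dots> = 2 powr \<tau> * (best_approx \<Phi> (2 ^ j) f + \<epsilon> j) powr \<tau>"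
      using eps[of j] best_approx_nonneg[of \<Phi> "2 ^ j" f] by (subst powr_mult) auto
    also have "\<dots> \<le> 2 powr \<tau> * (best_approx \<Phi> (2 ^ j) f powr \<tau> + \<epsilon> j powr \<tau>)"
      using eps[of j] \<tau> by (intro mult_left_mono powr_add_le best_approx_nonneg) auto
    finally have "(2 powr (r * \<tau>)) ^ j * enorm2 (y (Suc j) - y j) powr \<tau>
      \<le> (2 powr (r * \<tau>)) ^ j * (2 powr \<tau> * (best_approx \<Phi> (2 ^ j) f powr \<tau> + \<epsilon> j powr \<tau>))"
      by (rule mult_left_mono) simp
    also have "\<dots> = 2 powr \<tau> * ((2 powr (r * \<tau>)) ^ j * best_approx \<Phi> (2 ^ j) f powr \<tau> +
        (2 powr (r * \<tau>)) ^ j * \<epsilon> j powr \<tau>)"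
      by (simp add: algebra_simps)
    also have "(2 powr (r * \<tau>)) ^ j * \<epsilon> j powr \<tau> = e powr \<tau> * v ^ j"
    proof -
      have "(2 powr (r * \<tau>)) * (4 powr (- r * \<tau>)) = v"
      proof -
        have "(4::real) powr (- r * \<tau>) = (2 powr 2) powr (- r * \<tau>)" by simp
        also have "\<dots> = 2 powr (2 * (- r * \<tau>))" by (rule powr_powr)
        finally show ?thesis by (simp add: v_def mult.commute flip: powr_add)
      qed
      then show ?thesis
        using e by (simp add: \<epsilon>_def powr_mult powr_pow powr_powr power_mult_distrib[symmetric])
    qed
    finally show ?thesis .
  qed
  have geo: "(\<Sum>j<J. v ^ j) \<le> 1 / (1 - v)"
    using v by (simp add: sum_gp_strict divide_right_mono)
  have "(\<Sum>j<J. 4 powr (r * \<tau>) * ((2 powr (r * \<tau>)) ^ j * enorm2 (y (Suc j) - y j) powr \<tau>))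
      \<le> (\<Sum>j<J. 4 powr (r * \<tau>) * (2 powr \<tau> * ((2 powr (r * \<tau>)) ^ j * best_approx \<Phi> (2 ^ j) f powr \<tau> + e powr \<tau> * v ^ j)))"
    by (intro sum_mono mult_left_mono step) auto
  also have "\<dots> = 4 powr (r * \<tau>) * 2 powr \<tau> * (?S + e powr \<tau> * (\<Sum>j<J. v ^ j))"
    by (simp add: sum_distrib_left sum.distrib distrib_left mult_ac)
  also have "\<dots> \<le> 4 powr (r * \<tau>) * 2 powr \<tau> * (?S + e powr \<tau> * (1 / (1 - v)))"
    by (intro mult_left_mono add_left_mono geo) auto
  finally have sum: "(\<Sum>j<J. 4 powr (r * \<tau>) * ((2 powr (r * \<tau>)) ^ j * enorm2 (y (Suc j) - y j) powr \<tau>))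
    \<le> 4 powr (r * \<tau>) * 2 powr \<tau> * (?S + e powr \<tau> * (1 / (1 - v)))" .
  have S: "0 \<le> ?S" by (intro sum_nonneg) auto
  have "enorm2 (y 0) powr \<tau> +
      (\<Sum>j<J. 4 powr (r * \<tau>) * ((2 powr (r * \<tau>)) ^ j * enorm2 (y (Suc j) - y j) powr \<tau>))
    \<le> 3 powr \<tau> * e powr \<tau> + 4 powr (r * \<tau>) * 2 powr \<tau> * (?S + e powr \<tau> * (1 / (1 - v)))"
    using y0 sum by (rule add_mono)
  also have "\<dots> \<le> ?K * (e powr \<tau> + ?S)"
  proof -
    define a where "a = (4::real) powr (r * \<tau>) * 2 powr \<tau>"
    define b where "b = 1 / (1 - v)"
    have "0 \<le> a" "0 \<le> b" using v by (auto simp: a_def b_def)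
    then have "0 \<le> a * e powr \<tau> + 3 powr \<tau> * ?S + a * b * ?S" using S by auto
    then show ?thesis unfolding v_def[symmetric] a_def[symmetric] b_def[symmetric] by (simp add: algebra_simps)
  qed
  finally have "psum \<tau> c \<le> ?D * (?K * (e powr \<tau> + ?S))"
    using pc by (meson order_trans mult_left_mono powr_ge_zero)
  then show ?thesis using c y(3)[of J] by (intro bexI[of _ c]) (auto simp: e_def mult.assoc)
qed

end

lemma sparsity_le_approx:
  assumes \<tau>: "0 < \<tau>" "\<tau> \<le> 1" and r: "r = 1/\<tau> - 1/2"
  shows "\<exists>C>0. \<forall>m N \<Phi>. lrip_frame m N \<Phi> A B \<delta> \<kappa> \<longrightarrow>
    (\<forall>f\<in>carrier_vec m. sparsity_norm \<Phi> \<tau> f \<le> ennreal C * approx_norm \<Phi> r \<tau> f)"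
proof -
  \<comment> \<open>The added 1 makes \<open>K\<close> positive without any assumption on
    \<open>A\<close>, \<open>\<delta>\<close> and \<open>\<kappa>\<close>, which are constrained
    only inside the locale predicate.\<close>
  define K where "K = bernstein_const A \<delta> \<kappa> \<tau> powr \<tau> *
      (3 powr \<tau> + 4 powr (r * \<tau>) * 2 powr \<tau> * (1 + 1 / (1 - 2 powr - (r * \<tau>)))) + 1"
  define C where "C = (2 * K) powr (1/\<tau>) * 2 powr (1/\<tau>)"
  have rt: "0 < r * \<tau>" "r * \<tau> \<le> 1" using \<tau> by (auto simp: r field_simps)
  have v: "2 powr - (r * \<tau>) < 1" using rt by (intro powr_less_one) auto
  have K: "0 < K" unfolding K_def using v by (intro add_nonneg_pos mult_nonneg_nonneg add_nonneg_nonneg) auto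
  show ?thesis
  proof (intro exI[of _ C] conjI allI impI ballI)
    show "0 < C" using K by (simp add: C_def)
    fix m N \<Phi> and f :: "real Matrix.vec" assume "lrip_frame m N \<Phi> A B \<delta> \<kappa>" and f: "f \<in> carrier_vec m"
    then interpret lrip_frame m N \<Phi> A B \<delta> \<kappa> by simp
    define X where "X = (\<Sum>i. ennreal (approx_term \<Phi> r \<tau> f (Suc i)))"
    define e where "e = enorm2 f"
    show "sparsity_norm \<Phi> \<tau> f \<le> ennreal C * approx_norm \<Phi> r \<tau> f"
    proof (cases X)
      case top
      then show ?thesis using \<open>0 < C\<close>
        by (simp add: approx_norm_alt X_def[symmetric] epowr_top[unfolded infinity_ennreal_def] ennreal_mult_top)
    next
      case (real x)
      \<comment> \<open>\<open>J = N\<close> is admissible as \<open>N < 2 ^ N\<close>. The bound by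
        the infinite series then removes \<open>N\<close>.\<close>
      define S where "S = (\<Sum>j<N. (2 powr (r * \<tau>)) ^ j * best_approx \<Phi> (2 ^ j) f powr \<tau>)"
      have S0: "0 \<le> S" unfolding S_def by (intro sum_nonneg) auto
      have "ennreal S \<le> 2 * X" unfolding S_def X_def by (rule dyadic_approx_le) (use \<tau> rt in auto)
      also have "\<dots> = ennreal (2 * x)" using real by (simp add: ennreal_mult)
      finally have S: "S \<le> 2 * x" using real by (simp add: ennreal_le_iff)
      obtain c where c: "c \<in> carrier_vec N" "\<Phi> *\<^sub>v c = f" "psum \<tau> c \<le> (K - 1) * (e powr \<tau> + S)"
        using coefficients_le_dyadic[OF \<tau> r f, of N] less_imp_le[OF less_exp[of N]]
        unfolding K_def S_def e_def by auto
      have "psum \<tau> c \<le> K * (e powr \<tau> + S)"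
        using c(3) mult_right_mono[of "K - 1" K "e powr \<tau> + S"] S0 by simp
      also have "\<dots> \<le> K * (2 * (e powr \<tau> + x))"
      proof (rule mult_left_mono)
        have "0 \<le> e powr \<tau>" by simp
        then show "e powr \<tau> + S \<le> 2 * (e powr \<tau> + x)" using S by argo
      qed (use K in simp)
      finally have "lnorm \<tau> c \<le> (2 * K * (e powr \<tau> + x)) powr (1/\<tau>)"
        unfolding lnorm_psum using \<tau> by (intro powr_mono2) (auto simp: mult_ac)
      also have "\<dots> = (2 * K) powr (1/\<tau>) * (e powr \<tau> + x) powr (1/\<tau>)"
        using K real by (simp add: powr_mult)
      also have "\<dots> \<le> (2 * K) powr (1/\<tau>) * (2 powr (1/\<tau>) * ((e powr \<tau>) powr (1/\<tau>) + x powr (1/\<tau>)))"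
        using \<tau> real by (intro mult_left_mono powr_add_le_two) auto
      also have "\<dots> = C * (e + x powr (1/\<tau>))"
        using \<tau> by (simp add: C_def powr_powr e_def)
      finally have le: "lnorm \<tau> c \<le> C * (e + x powr (1/\<tau>))" .
      have "sparsity_norm \<Phi> \<tau> f \<le> ennreal (lnorm \<tau> c)"
        by (rule sparsity_norm_le) (use c in simp_all)
      also have "\<dots> \<le> ennreal (C * (e + x powr (1/\<tau>)))" using le by (rule ennreal_leI)
      also have "\<dots> = ennreal C * (ennreal e + ennreal (x powr (1/\<tau>)))"
        using \<open>0 < C\<close> by (simp add: ennreal_mult e_def flip: ennreal_plus)
      also have "\<dots> = ennreal C * approx_norm \<Phi> r \<tau> f"
        using real by (simp add: approx_norm_alt X_def[symmetric] epowr_ennreal e_def)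
      finally show ?thesis .
    qed
  qed
qed


section \<open>The interpolation norm\<close>

lemma geometric_step_exists:
  fixes q t :: real
  assumes "0 < q" "q < 1" "0 < t" "t \<le> 1"
  obtains j where "q ^ Suc j < t" "t \<le> q ^ j"
proof -
  obtain n where n: "q ^ n < t" using real_arch_pow_inv[OF assms(3,2)] by blast
  define k where "k = (LEAST n. q ^ n < t)"
  have k: "q ^ k < t" unfolding k_def by (rule LeastI[of _ n]) (rule n)
  have "k \<noteq> 0" using k assms by (cases k) auto
  then obtain j where j: "k = Suc j" by (cases k) auto
  have "\<not> q ^ j < t" using not_less_Least[of j "\<lambda>n. q ^ n < t"] j by (simp add: k_def)
  then show ?thesis using that[of j] k j by simp
qed

lemma geometric_step_disjoint:
  fixes q t :: real
  assumes "0 < q" "q < 1" "q ^ Suc i < t" "t \<le> q ^ i" "q ^ Suc j < t" "t \<le> q ^ j"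
  shows "i = j"
proof (rule ccontr)
  assume "i \<noteq> j"
  then have "Suc i \<le> j \<or> Suc j \<le> i" by linarith
  then have "q ^ j \<le> q ^ Suc i \<or> q ^ i \<le> q ^ Suc j"
    using assms by (meson less_imp_le power_decreasing)
  then show False using assms by linarith
qed

lemma nn_integral_step:
  fixes q :: real
  assumes q: "0 < q" "q < 1" and a: "0 \<le> a"
  shows "(\<integral>\<^sup>+t. ennreal a * indicator {q ^ Suc j<..q ^ j} t \<partial>lborel) = ennreal (a * (q ^ j - q ^ Suc j))"
proof -
  have "q ^ Suc j \<le> q ^ j" using q by (intro power_decreasing) auto
  then show ?thesis using a by (subst nn_integral_cmult_indicator) (simp_all add: ennreal_mult del: power_Suc)
qed

text \<open>Comparing with step functions avoids having to show that the K-functional is measurable in \<open>t\<close>.\<close>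

lemma nn_integral_geometric_steps_ge:
  fixes F :: "real \<Rightarrow> ennreal" and q :: real
  assumes q: "0 < q" "q < 1" and a: "\<And>j. 0 \<le> a j"
    and le: "\<And>j t. q ^ Suc j < t \<Longrightarrow> t \<le> q ^ j \<Longrightarrow> ennreal (a j) \<le> F t"
  shows "ennreal (\<Sum>j<J. a j * (q ^ j - q ^ Suc j)) \<le> (\<integral>\<^sup>+t\<in>{0<..}. F t \<partial>lborel)"
proof -
  let ?I = "\<lambda>j. {q ^ Suc j<..q ^ j}"
  have "ennreal (\<Sum>j<J. a j * (q ^ j - q ^ Suc j)) = (\<Sum>j<J. \<integral>\<^sup>+t. ennreal (a j) * indicator (?I j) t \<partial>lborel)"
    using q a power_decreasing[of _ "Suc _" q]
    by (subst nn_integral_step) (auto intro!: sum_ennreal[symmetric] mult_nonneg_nonneg power_decreasing simp del: power_Suc)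
  also have "\<dots> = (\<integral>\<^sup>+t. (\<Sum>j<J. ennreal (a j) * indicator (?I j) t) \<partial>lborel)"
    by (rule nn_integral_sum[symmetric]) simp
  also have "\<dots> \<le> (\<integral>\<^sup>+t\<in>{0<..}. F t \<partial>lborel)"
  proof (rule nn_integral_mono)
    fix t
    show "(\<Sum>j<J. ennreal (a j) * indicator (?I j) t) \<le> F t * indicator {0<..} t"
    proof (cases "\<exists>i. t \<in> ?I i")
      case True
      then obtain i where i: "t \<in> ?I i" by blast
      have pos: "0 < t" using i q by (auto intro: order.strict_trans[of 0 "q ^ Suc i"])
      have "(\<Sum>j<J. ennreal (a j) * indicator (?I j) t) = (\<Sum>j<J. if j = i then ennreal (a i) else 0)"
      proof (rule sum.cong)
        fix j assume "j \<in> {..<J}"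
        have "t \<in> ?I j \<longleftrightarrow> j = i"
          using geometric_step_disjoint[OF q, of i t j] i by auto
        then show "ennreal (a j) * indicator (?I j) t = (if j = i then ennreal (a i) else 0)"
          by (simp add: indicator_def)
      qed simp
      also have "\<dots> \<le> ennreal (a i)" by (simp add: sum.delta)
      also have "\<dots> \<le> F t" using i le by auto
      finally show ?thesis using pos by simp
    next
      case False
      then have "(\<Sum>j<J. ennreal (a j) * indicator (?I j) t) = 0" by (intro sum.neutral) auto
      then show ?thesis by simp
    qed
  qed
  finally show ?thesis .
qed

text \<open>Only the majorant is split into a sum of integrals, so only \<open>G\<close> has to be
  measurable. The point \<open>t = 1\<close> is covered twice, which does no harm in an upper
  bound.\<close>

lemma nn_integral_geometric_steps_le:
  fixes F :: "real \<Rightarrow> ennreal" and q :: real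
  assumes q: "0 < q" "q < 1" and a: "\<And>j. 0 \<le> a j"
    and le: "\<And>j t. q ^ Suc j < t \<Longrightarrow> t \<le> q ^ j \<Longrightarrow> F t \<le> ennreal (a j)"
    and tail: "\<And>t. 1 \<le> t \<Longrightarrow> F t \<le> ennreal (G t)" and meas: "G \<in> borel_measurable borel"
  shows "(\<integral>\<^sup>+t\<in>{0<..}. F t \<partial>lborel) \<le>
    (\<Sum>j. ennreal (a j * (q ^ j - q ^ Suc j))) + (\<integral>\<^sup>+t. ennreal (G t) * indicator {1..} t \<partial>lborel)"
proof -
  let ?I = "\<lambda>j. {q ^ Suc j<..q ^ j}"
  have "(\<integral>\<^sup>+t\<in>{0<..}. F t \<partial>lborel) \<le>
      (\<integral>\<^sup>+t. (\<Sum>j. ennreal (a j) * indicator (?I j) t) + ennreal (G t) * indicator {1..} t \<partial>lborel)"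
  proof (rule nn_integral_mono)
    fix t :: real
    consider "t \<le> 0" | "1 \<le> t" | "0 < t" "t \<le> 1" by linarith
    then show "F t * indicator {0<..} t \<le> (\<Sum>j. ennreal (a j) * indicator (?I j) t) + ennreal (G t) * indicator {1..} t"
    proof cases
      case 2
      then show ?thesis using tail[of t] by (simp add: add_increasing)
    next
      case 3
      obtain j where j: "q ^ Suc j < t" "t \<le> q ^ j" using geometric_step_exists[OF q 3] .
      have "F t \<le> (\<Sum>i\<in>{j}. ennreal (a i) * indicator (?I i) t)" using le[OF j] j by simp
      also have "\<dots> \<le> (\<Sum>i. ennreal (a i) * indicator (?I i) t)" by (intro sum_le_suminf) auto
      finally show ?thesis using 3 by (simp add: add_increasing2)
    qed simp
  qed
  also have "\<dots> = (\<integral>\<^sup>+t. (\<Sum>j. ennreal (a j) * indicator (?I j) t) \<partial>lborel) +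
      (\<integral>\<^sup>+t. ennreal (G t) * indicator {1..} t \<partial>lborel)"
    using meas by (intro nn_integral_add) auto
  also have "(\<integral>\<^sup>+t. (\<Sum>j. ennreal (a j) * indicator (?I j) t) \<partial>lborel) =
      (\<Sum>j. \<integral>\<^sup>+t. ennreal (a j) * indicator (?I j) t \<partial>lborel)"
    by (rule nn_integral_suminf) simp
  also have "\<dots> = (\<Sum>j. ennreal (a j * (q ^ j - q ^ Suc j)))"
    unfolding nn_integral_step[OF q a] ..
  finally show ?thesis .
qed

lemma nn_integral_powr_tail:
  fixes a :: real
  assumes "0 < a"
  shows "(\<integral>\<^sup>+t. ennreal (t powr (- a - 1)) * indicator {1..} t \<partial>lborel) = ennreal (1 / a)"
proof -
  have "(\<integral>\<^sup>+t. ennreal (t powr (- a - 1)) * indicator {1..} t \<partial>lborel) = ennreal (0 - - (1 powr (- a)) / a)"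
  proof (rule nn_integral_FTC_atLeast)
    fix x :: real assume "1 \<le> x"
    then show "((\<lambda>x. - (x powr (- a)) / a) has_real_derivative x powr (- a - 1)) (at x)"
      using assms by (auto intro!: derivative_eq_intros)
    show "0 \<le> x powr (- a - 1)" by simp
  next
    have "((\<lambda>x::real. x powr (- a)) \<longlongrightarrow> 0) at_top"
      using assms by (intro tendsto_neg_powr filterlim_ident) auto
    then have "((\<lambda>x::real. - (x powr (- a)) / a) \<longlongrightarrow> - 0 / a) at_top"
      by (intro tendsto_intros) (use assms in auto)
    then show "((\<lambda>x::real. - (x powr (- a)) / a) \<longlongrightarrow> 0) at_top" by simp
  qed simp
  then show ?thesis by simp
qed

lemma interp_integrand_ennreal:
  assumes "0 < t" "0 \<le> x"
  shows "epowr (ennreal (t powr (- \<theta>)) * ennreal x) q * ennreal (1 / t) = ennreal ((t powr (- \<theta>) * x) powr q / t)"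
  using assms by (simp add: ennreal_mult[symmetric] epowr_ennreal)

lemma epowr_mult_mono:
  assumes "x \<le> y" "0 \<le> q"
  shows "epowr (u * x) q * v \<le> epowr (u * y) q * v"
  using assms by (intro mult_right_mono epowr_mono mult_left_mono) auto

section \<open>Bounds for the K-functional\<close>

context lrip_frame
begin

text \<open>Two nested infima, over \<open>g\<close> and over the coefficients of \<open>g\<close>,
  are removed at once: it suffices to test single coefficient vectors.\<close>

lemma K_functional_ge:
  assumes t: "0 < t" and M: "0 < M"
    and le: "\<And>c. c \<in> carrier_vec N \<Longrightarrow> x \<le> M * (enorm2 (f - \<Phi> *\<^sub>v c) + t * lnorm p c)"
  shows "ennreal (x / M) \<le> K_functional \<Phi> p f t"
  unfolding K_functional_def
proof (rule INF_greatest)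
  fix g
  \<comment> \<open>The difference may be negative and is then truncated to 0 by
    \<open>ennreal\<close>; hence the case distinction when the norm is added back.\<close>
  have "ennreal (x / M - enorm2 (f - g)) \<le> ennreal t * sparsity_norm \<Phi> p g"
    unfolding sparsity_norm_def
  proof (rule ennreal_le_cmult_INF[OF t])
    fix c assume "c \<in> {c \<in> carrier_vec (dim_col \<Phi>). \<Phi> *\<^sub>v c = g}"
    then have "x \<le> M * (enorm2 (f - g) + t * lnorm p c)" using le[of c] by auto
    then have "x / M \<le> enorm2 (f - g) + t * lnorm p c" using M by (simp add: pos_divide_le_eq mult.commute)
    then have "x / M - enorm2 (f - g) \<le> t * lnorm p c" by linarith
    then show "ennreal (x / M - enorm2 (f - g)) \<le> ennreal t * ennreal (lnorm p c)"
      using t by (simp add: ennreal_mult[symmetric] ennreal_leI)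
  qed
  then have "ennreal (enorm2 (f - g)) + ennreal (x / M - enorm2 (f - g))
      \<le> ennreal (enorm2 (f - g)) + ennreal t * sparsity_norm \<Phi> p g"
    by (rule add_left_mono)
  moreover have "ennreal (x / M) \<le> ennreal (enorm2 (f - g)) + ennreal (x / M - enorm2 (f - g))"
  proof (cases "enorm2 (f - g) \<le> x / M")
    case True
    then show ?thesis by (simp flip: ennreal_plus)
  next
    case False
    then show ?thesis by (intro add_increasing2 ennreal_leI) auto
  qed
  ultimately show "ennreal (x / M) \<le> ennreal (enorm2 (f - g)) + ennreal t * sparsity_norm \<Phi> p g"
    by (rule order_trans[rotated])
qed

lemma enorm2_mult_le_lnorm:
  assumes "c \<in> carrier_vec N" "0 < p" "p \<le> 2"
  shows "enorm2 (\<Phi> *\<^sub>v c) \<le> sqrt B * lnorm p c"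
proof -
  have "enorm2 c \<le> lnorm p c"
    using lnorm_antimono[OF assms(2,3), of c] by (simp add: lnorm_2_eq_enorm2)
  then show ?thesis
    using enorm2_mult_le[OF assms(1)] A_pos A_le_B
    by (meson order_trans mult_left_mono real_sqrt_ge_zero less_imp_le)
qed

text \<open>The error of best approximation is 1-Lipschitz in the vector, so passing from
  \<open>f\<close> to \<open>g\<close> costs the first summand of the K-functional and Jackson's
  inequality for \<open>g\<close> costs the second.\<close>

lemma best_approx_le_K:
  assumes p: "0 < p" "p \<le> 2" and f: "f \<in> carrier_vec m" and k: "0 < k"
    and t: "real k powr - (1/p - 1/2) \<le> t" and M: "1 \<le> M" "sqrt B \<le> M"
  shows "ennreal (best_approx \<Phi> k f / M) \<le> K_functional \<Phi> p f t"
proof (rule K_functional_ge)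
  show t0: "0 < t" using t k by (auto intro: order.strict_trans2[rotated])
  fix c :: "real Matrix.vec" assume c: "c \<in> carrier_vec N"
  let ?g = "\<Phi> *\<^sub>v c"
  have "best_approx \<Phi> k ?g \<le> sqrt B * real k powr - (1/p - 1/2) * lnorm p c"
    by (rule jackson[OF c k p])
  also have "\<dots> \<le> M * t * lnorm p c"
    using t M by (intro mult_right_mono mult_mono) auto
  finally have jack: "best_approx \<Phi> k ?g \<le> M * t * lnorm p c" .
  have "best_approx \<Phi> k f \<le> enorm2 (f - ?g) + best_approx \<Phi> k ?g"
  \<comment> \<open>Attainment of the infimum is avoided by working with near-best elements.\<close>
  proof (rule field_le_epsilon)
    fix e :: real assume "0 < e"
    then obtain y where y: "y \<in> sparse_set \<Phi> k" "enorm2 (?g - y) < best_approx \<Phi> k ?g + e"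
      using best_approx_near by blast
    have "best_approx \<Phi> k f \<le> enorm2 (f - y)" by (rule best_approx_le[OF y(1)])
    also have "\<dots> \<le> enorm2 (f - ?g) + enorm2 (?g - y)"
      by (rule enorm2_triangle[OF f mult_carrier]) (use sparse_set_carrier[OF y(1)] in simp)
    finally show "best_approx \<Phi> k f \<le> enorm2 (f - ?g) + best_approx \<Phi> k ?g + e" using y by simp
  qed
  also have "\<dots> \<le> M * enorm2 (f - ?g) + M * t * lnorm p c"
    using jack M mult_right_mono[of 1 M "enorm2 (f - ?g)"] by (intro add_mono) auto
  finally show "best_approx \<Phi> k f \<le> M * (enorm2 (f - ?g) + t * lnorm p c)"
    by (simp add: distrib_left)
qed (use M in simp)

lemma enorm2_le_K:
  assumes p: "0 < p" "p \<le> 2" and f: "f \<in> carrier_vec m" and t: "1 \<le> t" and M: "1 \<le> M" "sqrt B \<le> M"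
  shows "ennreal (enorm2 f / M) \<le> K_functional \<Phi> p f t"
proof (rule K_functional_ge)
  fix c :: "real Matrix.vec" assume c: "c \<in> carrier_vec N"
  let ?g = "\<Phi> *\<^sub>v c"
  have "enorm2 f \<le> enorm2 (f - ?g) + enorm2 ?g"
    using enorm2_triangle[OF f mult_carrier[of c] zero_carrier_vec] f by simp
  also have "enorm2 ?g \<le> sqrt B * lnorm p c" by (rule enorm2_mult_le_lnorm[OF c p])
  also have "sqrt B * lnorm p c \<le> M * (t * lnorm p c)"
    using t M mult_right_mono[OF t, of "lnorm p c"] by (intro mult_mono) auto
  also have "enorm2 (f - ?g) \<le> M * enorm2 (f - ?g)"
    using M mult_right_mono[of 1 M "enorm2 (f - ?g)"] by simp
  finally show "enorm2 f \<le> M * (enorm2 (f - ?g) + t * lnorm p c)"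
    by (simp add: distrib_left)
qed (use M t in auto)

lemma K_functional_le:
  assumes d: "d \<in> carrier_vec N" and c: "c \<in> carrier_vec N" and t: "0 \<le> t"
  shows "K_functional \<Phi> p (\<Phi> *\<^sub>v c) t \<le> ennreal (sqrt B * enorm2 (c - d) + t * lnorm p d)"
proof -
  have "K_functional \<Phi> p (\<Phi> *\<^sub>v c) t \<le>
      ennreal (enorm2 (\<Phi> *\<^sub>v c - \<Phi> *\<^sub>v d)) + ennreal t * sparsity_norm \<Phi> p (\<Phi> *\<^sub>v d)"
    unfolding K_functional_def by (rule INF_lower) (simp add: sparsity_space_eq)
  also have "\<dots> \<le> ennreal (sqrt B * enorm2 (c - d)) + ennreal t * ennreal (lnorm p d)"
  proof (intro add_mono ennreal_leI mult_left_mono sparsity_norm_le)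
    have "\<Phi> *\<^sub>v c - \<Phi> *\<^sub>v d = \<Phi> *\<^sub>v (c - d)"
      using mult_minus_distrib_mat_vec[OF carrier c d] by simp
    then show "enorm2 (\<Phi> *\<^sub>v c - \<Phi> *\<^sub>v d) \<le> sqrt B * enorm2 (c - d)"
      using c d by (simp add: enorm2_mult_le)
  qed (use d in auto)
  also have "\<dots> = ennreal (sqrt B * enorm2 (c - d) + t * lnorm p d)"
    using t A_pos A_le_B by (simp add: ennreal_mult)
  finally show ?thesis .
qed

end


section \<open>Comparison of the interpolation norm with the other two\<close>

lemma exponent_facts:
  fixes \<tau> \<theta> r p :: real
  assumes "0 < \<tau>" "\<tau> \<le> 1" "0 < \<theta>" "\<theta> < 1" "r = 1/\<tau> - 1/2" "0 < p" "1/\<tau> = \<theta>/p + (1 - \<theta>)/2"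
  shows "p < \<tau>" "r = \<theta> * (1/p - 1/2)" "0 < r" "r * \<tau> = 1 - \<tau>/2"
proof -
  have "1 \<le> 1/\<tau>" using assms(1,2) by simp
  then show "0 < r" using assms(5) by linarith
  show "r * \<tau> = 1 - \<tau>/2" using assms(1,5) by (simp add: left_diff_distrib)
  show "r = \<theta> * (1/p - 1/2)" using assms by (simp add: algebra_simps add_divide_distrib diff_divide_distrib)
  \<comment> \<open>\<open>1/\<tau>\<close> is a proper convex combination of \<open>1/p\<close> and
    \<open>1/2\<close> and exceeds \<open>1/2\<close>, so it lies strictly below
    \<open>1/p\<close>.\<close>
  have "\<theta> * (1/p - 1/\<tau>) = (1 - \<theta>) * (1/\<tau> - 1/2)"
    using assms(7) by (simp add: algebra_simps diff_divide_distrib)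
  moreover have "0 < (1 - \<theta>) * (1/\<tau> - 1/2)"
    using assms(4,5) \<open>0 < r\<close> by (intro mult_pos_pos) auto
  ultimately have "0 < \<theta> * (1/p - 1/\<tau>)" by argo
  then have "0 < 1/p - 1/\<tau>" using assms(3) by (simp only: zero_less_mult_pos)
  then have "1/\<tau> < 1/p" by simp
  then show "p < \<tau>" using assms(1,6) by (simp add: divide_less_eq_1_pos frac_less2 field_simps)
qed

text \<open>Two parts of the integral are used: the geometric steps below 1 control the errors for k
  = 2, 4, 8, ..., while the interval from 1 to 2 controls the norm of \<open>f\<close>, and with it
  the error for k = 1.\<close>

lemma approx_le_interp:
  fixes \<tau> \<theta> r p :: real
  assumes par: "0 < \<tau>" "\<tau> \<le> 1" "0 < \<theta>" "\<theta> < 1" "r = 1/\<tau> - 1/2" "0 < p" "1/\<tau> = \<theta>/p + (1 - \<theta>)/2"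
  shows "\<exists>C>0. \<forall>m N \<Phi>. lrip_frame m N \<Phi> A B \<delta> \<kappa> \<longrightarrow>
    (\<forall>f\<in>carrier_vec m. approx_norm \<Phi> r \<tau> f \<le> ennreal C * interp_norm \<Phi> p \<theta> \<tau> f)"
proof -
  note ex = exponent_facts[OF par]
  define M where "M = max 1 (sqrt B)"
  \<comment> \<open>So \<open>q ^ j\<close> is 2^j to the power -\<rho>, the smallest
    \<open>t\<close> at which Jackson's inequality with 2^j terms applies, and
    \<open>q powr - \<theta>\<close> is the dyadic weight \<open>2 powr r\<close>.\<close>
  define q where "q = 2 powr - (1/p - 1/2)"
  \<comment> \<open>From the interval from 1 to 2, where
    \<open>t powr - \<theta> \<ge> 2 powr - \<theta>\<close> and
    \<open>1 / t \<ge> 1 / 2\<close>.\<close>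
  define Ce where "Ce = 2 * (M * 2 powr \<theta>) powr \<tau>"
  \<comment> \<open>\<open>Ce\<close> accounts for k = 1, \<open>2 powr (r * \<tau>)\<close> for the
    index shift from \<open>j\<close> to \<open>Suc j\<close>, and \<open>1 - q\<close> for the
    relative length of a step.\<close>
  define Cs where "Cs = Ce + 2 powr (r * \<tau>) * M powr \<tau> / (1 - q)"
  define C where "C = Ce powr (1/\<tau>) + Cs powr (1/\<tau>)"
  have M: "1 \<le> M" "sqrt B \<le> M" by (auto simp: M_def)
  have p2: "p \<le> 2" using ex par by simp
  have "0 < 1/p - 1/2" using ex(2,3) par by (simp add: zero_less_mult_iff)
  then have q: "0 < q" "q < 1" by (auto simp: q_def powr_less_one)
  have Ce: "0 < Ce" using M by (simp add: Ce_def)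
  have Cs: "0 < Cs" unfolding Cs_def using Ce q by (intro add_pos_nonneg) auto
  have q\<theta>: "q powr - \<theta> = 2 powr r" unfolding q_def powr_powr ex(2) by (simp add: algebra_simps)
  have rt: "r * \<tau> \<le> 1" using ex par by simp
  show ?thesis
  proof (intro exI[of _ C] conjI allI impI ballI)
    show "0 < C" using Ce Cs by (simp add: C_def add_pos_pos)
    fix m N \<Phi> and f :: "real Matrix.vec" assume "lrip_frame m N \<Phi> A B \<delta> \<kappa>" and f: "f \<in> carrier_vec m"
    then interpret lrip_frame m N \<Phi> A B \<delta> \<kappa> by simp
    define e where "e = enorm2 f"
    have e: "0 \<le> e" by (simp add: e_def)
    define F where "F t = epowr (ennreal (t powr (- \<theta>)) * K_functional \<Phi> p f t) \<tau> * ennreal (1 / t)" for t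
    define I where "I = (\<integral>\<^sup>+t\<in>{0<..}. F t \<partial>lborel)"
    have norm: "interp_norm \<Phi> p \<theta> \<tau> f = epowr I (1/\<tau>)" by (simp add: interp_norm_def I_def F_def)
    define \<sigma> where "\<sigma> j = best_approx \<Phi> (2 ^ j) f" for j
    have \<sigma>: "0 \<le> \<sigma> j" for j by (simp add: \<sigma>_def best_approx_nonneg)
    \<comment> \<open>On step \<open>j\<close> the weights are smallest at the right end
      \<open>q ^ j\<close>, but only \<open>t > q ^ Suc j\<close> is known, so Jackson's inequality
      is available for 2^(j+1) terms, not for 2^j.\<close>
    define a where "a j = ((q ^ j) powr - \<theta> * (\<sigma> (Suc j) / M)) powr \<tau> / q ^ j" for j
    have F_ge: "ennreal ((t powr (- \<theta>) * x) powr \<tau> / t) \<le> F t"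
      if "0 < t" "0 \<le> x" "ennreal x \<le> K_functional \<Phi> p f t" for t x
      unfolding F_def interp_integrand_ennreal[OF that(1,2), symmetric]
      using that par by (intro epowr_mult_mono) auto
    have steps: "ennreal (\<Sum>j<J. a j * (q ^ j - q ^ Suc j)) \<le> I" for J
      unfolding I_def
    proof (rule nn_integral_geometric_steps_ge[OF q])
      show "0 \<le> a j" for j using q by (simp add: a_def)
      fix j t assume t: "q ^ Suc j < t" "t \<le> q ^ j"
      have t0: "0 < t" using q t(1) by (auto intro: order.strict_trans[of 0 "q ^ Suc j"] simp del: power_Suc)
      have "real (2 ^ Suc j) powr - (1/p - 1/2) = q ^ Suc j"
        unfolding q_def by (rule powr_two_pow)
      then have K: "ennreal (\<sigma> (Suc j) / M) \<le> K_functional \<Phi> p f t"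
        unfolding \<sigma>_def using t by (intro best_approx_le_K par p2 f M) auto
      have "(q ^ j) powr - \<theta> \<le> t powr - \<theta>" using t t0 par by (intro powr_mono2') auto
      then have "((q ^ j) powr - \<theta> * (\<sigma> (Suc j) / M)) powr \<tau> \<le> (t powr - \<theta> * (\<sigma> (Suc j) / M)) powr \<tau>"
        using \<sigma> M par by (intro powr_mono2[OF less_imp_le[OF par(1)]] mult_right_mono) auto
      then have "a j \<le> (t powr - \<theta> * (\<sigma> (Suc j) / M)) powr \<tau> / t"
        unfolding a_def using t t0 q by (intro frac_le) auto
      then have "ennreal (a j) \<le> ennreal ((t powr - \<theta> * (\<sigma> (Suc j) / M)) powr \<tau> / t)" by (rule ennreal_leI)
      also have "\<dots> \<le> F t" using t0 \<sigma> M K by (intro F_ge) auto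
      finally show "ennreal (a j) \<le> F t" .
    qed
    have a_eq: "a j * (q ^ j - q ^ Suc j) = (1 - q) / M powr \<tau> * ((2 powr (r * \<tau>)) ^ j * \<sigma> (Suc j) powr \<tau>)" for j
    proof -
      have "a j = ((2 powr r) ^ j * (\<sigma> (Suc j) / M)) powr \<tau> / q ^ j"
        using q by (simp add: a_def powr_pow q\<theta>)
      also have "((2 powr r) ^ j * (\<sigma> (Suc j) / M)) powr \<tau> = (2 powr (r * \<tau>)) ^ j * (\<sigma> (Suc j) powr \<tau> / M powr \<tau>)"
        using \<sigma> M by (simp add: powr_mult powr_divide powr_pow powr_powr)
      finally have "a j * q ^ j = (2 powr (r * \<tau>)) ^ j * (\<sigma> (Suc j) powr \<tau> / M powr \<tau>)" using q by simp
      moreover have "a j * (q ^ j - q ^ Suc j) = (1 - q) * (a j * q ^ j)" by (simp add: algebra_simps)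
      ultimately show ?thesis by simp
    qed
    have tail: "ennreal (e powr \<tau> / Ce) \<le> I"
    proof -
      define b where "b = (2 powr - \<theta> * (e / M)) powr \<tau> / 2"
      have b0: "0 \<le> b" by (simp add: b_def)
      have "b = e powr \<tau> / Ce"
        using e M by (simp add: b_def Ce_def powr_mult powr_divide powr_minus field_simps)
      then have "ennreal (e powr \<tau> / Ce) = ennreal b * emeasure lborel {1..2::real}" by simp
      also have "\<dots> = (\<integral>\<^sup>+t. ennreal b * indicator {1..2::real} t \<partial>lborel)"
        by (rule nn_integral_cmult_indicator[symmetric]) simp
      also have "\<dots> \<le> I"
        unfolding I_def
      proof (rule nn_integral_mono)
        fix t :: real
        show "ennreal b * indicator {1..2} t \<le> F t * indicator {0<..} t"
        proof (cases "1 \<le> t \<and> t \<le> 2")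
          case True
          have "2 powr - \<theta> \<le> t powr - \<theta>" using True par by (intro powr_mono2') auto
          then have "(2 powr - \<theta> * (e / M)) powr \<tau> \<le> (t powr - \<theta> * (e / M)) powr \<tau>"
            using e M par by (intro powr_mono2[OF less_imp_le[OF par(1)]] mult_right_mono) auto
          then have "b \<le> (t powr - \<theta> * (e / M)) powr \<tau> / t"
            unfolding b_def using True by (intro frac_le) auto
          then have "ennreal b \<le> ennreal ((t powr - \<theta> * (e / M)) powr \<tau> / t)" by (rule ennreal_leI)
          also have "\<dots> \<le> F t"
            using True e M unfolding e_def by (intro F_ge enorm2_le_K par p2 f) auto
          finally show ?thesis using True by simp
        qed auto
      qed
      finally show ?thesis .
    qed
    show "approx_norm \<Phi> r \<tau> f \<le> ennreal C * interp_norm \<Phi> p \<theta> \<tau> f"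
    proof (cases I)
      case top
      then show ?thesis using \<open>0 < C\<close>
        by (simp add: norm epowr_top[unfolded infinity_ennreal_def] ennreal_mult_top)
    next
      case (real x)
      have e_le: "e powr \<tau> \<le> Ce * x"
        using tail real Ce by (simp add: ennreal_le_iff pos_divide_le_eq mult.commute)
      have sum_le: "(\<Sum>j<L. (2 powr (r * \<tau>)) ^ j * \<sigma> j powr \<tau>) \<le> Cs * x" for L
      proof -
        have "(1 - q) / M powr \<tau> * (\<Sum>j<L. (2 powr (r * \<tau>)) ^ j * \<sigma> (Suc j) powr \<tau>) \<le> x"
          using steps[of L] real unfolding a_eq sum_distrib_left[symmetric] by (simp add: ennreal_le_iff)
        then have s: "(\<Sum>j<L. (2 powr (r * \<tau>)) ^ j * \<sigma> (Suc j) powr \<tau>) \<le> M powr \<tau> / (1 - q) * x"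
          using q M by (simp add: field_simps)
        have "(\<Sum>j<L. (2 powr (r * \<tau>)) ^ j * \<sigma> j powr \<tau>) \<le> (\<Sum>j<Suc L. (2 powr (r * \<tau>)) ^ j * \<sigma> j powr \<tau>)"
          by simp
        also have "\<dots> = \<sigma> 0 powr \<tau> + 2 powr (r * \<tau>) * (\<Sum>j<L. (2 powr (r * \<tau>)) ^ j * \<sigma> (Suc j) powr \<tau>)"
          unfolding sum.lessThan_Suc_shift by (simp add: sum_distrib_left mult.assoc)
        also have "\<dots> \<le> Ce * x + 2 powr (r * \<tau>) * (M powr \<tau> / (1 - q) * x)"
        proof (intro add_mono mult_left_mono s)
          have "\<sigma> 0 powr \<tau> \<le> e powr \<tau>"
            using f par best_approx_le_enorm2[of f \<Phi>] by (intro powr_mono2) (auto simp: \<sigma>_def e_def best_approx_nonneg)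
          then show "\<sigma> 0 powr \<tau> \<le> Ce * x" using e_le by simp
        qed simp
        finally show ?thesis by (simp add: Cs_def algebra_simps)
      qed
      have "approx_norm \<Phi> r \<tau> f \<le> ennreal e + epowr (ennreal (Cs * x)) (1/\<tau>)"
        unfolding approx_norm_alt e_def using par rt sum_le[unfolded \<sigma>_def]
        by (intro add_left_mono epowr_mono suminf_approx_term_le) auto
      also have "\<dots> = ennreal (e + Cs powr (1/\<tau>) * x powr (1/\<tau>))"
        using Cs real e by (simp add: epowr_ennreal powr_mult)
      also have "\<dots> \<le> ennreal (C * x powr (1/\<tau>))"
      proof (rule ennreal_leI)
        have "(e powr \<tau>) powr (1/\<tau>) \<le> (Ce * x) powr (1/\<tau>)"
          using e_le par by (intro powr_mono2) auto
        then have "e \<le> Ce powr (1/\<tau>) * x powr (1/\<tau>)"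
          using e par(1) Ce real by (simp add: powr_powr powr_mult)
        then show "e + Cs powr (1/\<tau>) * x powr (1/\<tau>) \<le> C * x powr (1/\<tau>)"
          by (simp add: C_def distrib_right)
      qed
      also have "\<dots> = ennreal C * interp_norm \<Phi> p \<theta> \<tau> f"
        using real \<open>0 < C\<close> by (simp add: norm epowr_ennreal ennreal_mult)
      finally show ?thesis .
    qed
  qed
qed

text \<open>The infimum over representations is removed first, so a single \<open>c\<close> and the
  truncations of its rearrangement serve all \<open>t\<close>.\<close>

lemma interp_le_sparsity:
  fixes A B \<tau> \<theta> r p :: real
  assumes par: "0 < \<tau>" "\<tau> \<le> 1" "0 < \<theta>" "\<theta> < 1" "r = 1/\<tau> - 1/2" "0 < p" "1/\<tau> = \<theta>/p + (1 - \<theta>)/2"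
    and AB: "0 < A" "A \<le> B"
  shows "\<exists>C>0. \<forall>m N \<Phi>. lrip_frame m N \<Phi> A B \<delta> \<kappa> \<longrightarrow>
    (\<forall>f\<in>carrier_vec m. interp_norm \<Phi> p \<theta> \<tau> f \<le> ennreal C * sparsity_norm \<Phi> \<tau> f)"
proof -
  note ex = exponent_facts[OF par]
  define q where "q = 2 powr - (1/p - 1/2)"
  have p2: "p \<le> 2" using ex par by simp
  have "0 < 1/p - 1/2" using ex(2,3) par by (simp add: zero_less_mult_iff)
  then have q: "0 < q" "q < 1" by (auto simp: q_def powr_less_one)
  have q\<theta>: "q powr - \<theta> = 2 powr r" unfolding q_def powr_powr ex(2) by (simp add: algebra_simps)
  obtain Ch where Ch: "0 < Ch" and head: "\<And>(b::nat \<Rightarrow> real) N J. (\<forall>i. 0 \<le> b i) \<and> antimono b \<and> (\<forall>i\<ge>N. b i = 0) \<Longrightarrow>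
    (\<Sum>j<J. (2 powr (1 - \<tau>/p))^j * (\<Sum>i<2^j. b i powr p) powr (\<tau>/p)) \<le> Ch * (\<Sum>i<N. b i powr \<tau>)"
    using hardy_head_sum[OF par(6) ex(1)] by blast
  define Ct where "Ct = 2 / (1 - 2 powr (\<tau>/2 - 1))"
  have "2 powr (\<tau>/2 - 1) < 1" using par by (intro powr_less_one) auto
  then have Ct: "0 < Ct" by (simp add: Ct_def)
  \<comment> \<open>The price of evaluating \<open>t powr - \<theta>\<close> and
    \<open>1 / t\<close> at the left end of a step instead of the right end.\<close>
  define G0 where "G0 = 2 powr (r * \<tau>) / q"
  have G0: "0 < G0" using q by (simp add: G0_def)
  \<comment> \<open>The summands come from the tails, the heads and the integral over
    \<open>t \<ge> 1\<close>; the last gives the denominator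
    \<open>\<theta> * \<tau>\<close>.\<close>
  define C where "C = G0 * (sqrt B powr \<tau> * Ct + Ch) + sqrt B powr \<tau> / (\<theta> * \<tau>)"
  have sB: "0 < sqrt B" using AB by simp
  have C: "0 < C" unfolding C_def
    using G0 Ct Ch par by (intro add_pos_nonneg mult_pos_pos add_nonneg_pos mult_nonneg_nonneg) auto
  show ?thesis
  proof (intro exI[of _ "C powr (1/\<tau>)"] conjI allI impI ballI)
    show "0 < C powr (1/\<tau>)" using C by simp
    fix m N \<Phi> and f :: "real Matrix.vec" assume "lrip_frame m N \<Phi> A B \<delta> \<kappa>" and f: "f \<in> carrier_vec m"
    then interpret lrip_frame m N \<Phi> A B \<delta> \<kappa> by simp
    show "interp_norm \<Phi> p \<theta> \<tau> f \<le> ennreal (C powr (1/\<tau>)) * sparsity_norm \<Phi> \<tau> f"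
      unfolding sparsity_norm_def
    proof (rule ennreal_le_cmult_INF)
      show "0 < C powr (1/\<tau>)" using C by simp
      fix c assume "c \<in> {c \<in> carrier_vec (dim_col \<Phi>). \<Phi> *\<^sub>v c = f}"
      then have c: "c \<in> carrier_vec N" and fc: "f = \<Phi> *\<^sub>v c" by auto
      obtain b h where b: "\<And>i. 0 \<le> b i" "antimono b" "\<And>i. N \<le> i \<Longrightarrow> b i = 0"
        and h: "\<And>k. h k \<in> carrier_vec N" "\<And>k. nnz (h k) \<le> k"
        and psum_h: "\<And>k s. psum s (h k) = (\<Sum>i<k. b i powr s)"
        and tail: "\<And>k. (enorm2 (c - h k))\<^sup>2 = (\<Sum>i\<in>{k..<N}. (b i)\<^sup>2)"
        and psum_c: "\<And>s. psum s c = (\<Sum>i<N. b i powr s)"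
        by (rule decreasing_rearrangement[OF c]) (rule that)
      define S where "S = psum \<tau> c"
      have S: "0 \<le> S" by (simp add: S_def)
      define T where "T j = (\<Sum>i\<in>{2^j..<N}. (b i)\<^sup>2)" for j :: nat
      define H where "H j = (\<Sum>i<2^j. b i powr p)" for j :: nat
      have T: "0 \<le> T j" and H: "0 \<le> H j" for j by (auto simp: T_def H_def intro: sum_nonneg)
      define W where "W j = sqrt B * T j powr (1/2) + q ^ j * H j powr (1/p)" for j
      have W: "0 \<le> W j" for j using sB q by (simp add: W_def)
      \<comment> \<open>The weights are largest at the left end \<open>q ^ Suc j\<close>, whereas
        \<open>W j\<close> bounds the K-functional with \<open>t\<close> at the right end
        \<open>q ^ j\<close>.\<close>
      define a where "a j = ((q ^ Suc j) powr - \<theta> * W j) powr \<tau> / q ^ Suc j" for j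
      define e where "e = enorm2 f"
      have e: "0 \<le> e" by (simp add: e_def)
      define F where "F t = epowr (ennreal (t powr (- \<theta>)) * K_functional \<Phi> p f t) \<tau> * ennreal (1 / t)" for t
      have F_le: "F t \<le> ennreal ((t powr (- \<theta>) * x) powr \<tau> / t)"
        if "0 < t" "0 \<le> x" "K_functional \<Phi> p f t \<le> ennreal x" for t x
        unfolding F_def interp_integrand_ennreal[OF that(1,2), symmetric]
        using that par by (intro epowr_mult_mono) auto
      have "(\<integral>\<^sup>+t\<in>{0<..}. F t \<partial>lborel) \<le> (\<Sum>j. ennreal (a j * (q ^ j - q ^ Suc j))) +
          (\<integral>\<^sup>+t. ennreal (e powr \<tau> * t powr (- (\<theta> * \<tau>) - 1)) * indicator {1..} t \<partial>lborel)"
      proof (rule nn_integral_geometric_steps_le[OF q])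
        show "0 \<le> a j" for j using q by (simp add: a_def)
      next
        fix j t assume t: "q ^ Suc j < t" "t \<le> q ^ j"
        have t0: "0 < t" using q t(1) by (auto intro: order.strict_trans[of 0 "q ^ Suc j"] simp del: power_Suc)
        have "K_functional \<Phi> p f t \<le> ennreal (sqrt B * enorm2 (c - h (2^j)) + t * lnorm p (h (2^j)))"
          unfolding fc using t0 by (intro K_functional_le h c) auto
        also have "enorm2 (c - h (2^j)) = T j powr (1/2)"
          using T[of j] by (simp add: T_def powr_half_sqrt flip: tail)
        also have "lnorm p (h (2^j)) = H j powr (1/p)" by (simp add: lnorm_psum psum_h H_def)
        also have "ennreal (sqrt B * T j powr (1/2) + t * H j powr (1/p)) \<le> ennreal (W j)"
          unfolding W_def using t by (intro ennreal_leI add_left_mono mult_right_mono) auto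
        finally have "F t \<le> ennreal ((t powr (- \<theta>) * W j) powr \<tau> / t)"
          using t0 W by (intro F_le) auto
        also have "\<dots> \<le> ennreal (a j)"
          unfolding a_def
        proof (intro ennreal_leI frac_le powr_mono2[OF less_imp_le[OF par(1)]] mult_right_mono)
          show "t powr - \<theta> \<le> (q ^ Suc j) powr - \<theta>"
            using t q par by (intro powr_mono2') (auto simp del: power_Suc)
        qed (use t t0 q par W in \<open>auto simp del: power_Suc\<close>)
        finally show "F t \<le> ennreal (a j)" .
      next
        \<comment> \<open>For large \<open>t\<close> the choice \<open>g = 0\<close> removes the
          factor \<open>t\<close>, and the weight \<open>t powr (- \<theta>)\<close> then makes the
          integral converge at infinity.\<close>
        fix t :: real assume t: "1 \<le> t"
        have "K_functional \<Phi> p f t \<le> ennreal (enorm2 (f - 0\<^sub>v m)) + ennreal t * sparsity_norm \<Phi> p (0\<^sub>v m)"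
          unfolding K_functional_def by (rule INF_lower) (simp add: sparsity_space_eq)
        also have "sparsity_norm \<Phi> p (0\<^sub>v m) = 0"
        proof -
          have "\<Phi> *\<^sub>v 0\<^sub>v N = 0\<^sub>v m" using carrier by (intro eq_vecI) auto
          then have "sparsity_norm \<Phi> p (0\<^sub>v m) \<le> ennreal (lnorm p (0\<^sub>v N))"
            by (intro sparsity_norm_le) auto
          then show ?thesis by (simp add: lnorm_psum)
        qed
        also have "f - 0\<^sub>v m = f" using f by auto
        finally have "F t \<le> ennreal ((t powr (- \<theta>) * e) powr \<tau> / t)"
          using t e by (intro F_le) (auto simp: e_def)
        also have "(t powr (- \<theta>) * e) powr \<tau> / t = e powr \<tau> * t powr (- (\<theta> * \<tau>) - 1)"
          using t e by (simp add: powr_mult powr_powr powr_diff)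
        finally show "F t \<le> ennreal (e powr \<tau> * t powr (- (\<theta> * \<tau>) - 1))" .
      qed simp
      also have "(\<integral>\<^sup>+t. ennreal (e powr \<tau> * t powr (- (\<theta> * \<tau>) - 1)) * indicator {1..} t \<partial>lborel)
          = ennreal (e powr \<tau>) * (\<integral>\<^sup>+t. ennreal (t powr (- (\<theta> * \<tau>) - 1)) * indicator {1..} t \<partial>lborel)"
        by (subst nn_integral_cmult[symmetric]) (auto simp: ennreal_mult mult.assoc)
      also have "\<dots> = ennreal (e powr \<tau> / (\<theta> * \<tau>))"
        using par by (subst nn_integral_powr_tail) (auto simp: ennreal_mult[symmetric])
      also have "\<dots> \<le> ennreal (sqrt B powr \<tau> / (\<theta> * \<tau>) * S)"
      proof (rule ennreal_leI)
        have "e \<le> sqrt B * lnorm \<tau> c"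
          unfolding e_def fc using par by (intro enorm2_mult_le_lnorm c) auto
        then have "e powr \<tau> \<le> (sqrt B * lnorm \<tau> c) powr \<tau>" using e par by (intro powr_mono2) auto
        also have "\<dots> = sqrt B powr \<tau> * S"
          using sB par by (simp add: powr_mult S_def psum_lnorm)
        finally show "e powr \<tau> / (\<theta> * \<tau>) \<le> sqrt B powr \<tau> / (\<theta> * \<tau>) * S"
          using par by (simp add: divide_right_mono)
      qed
      also have "(\<Sum>j. ennreal (a j * (q ^ j - q ^ Suc j))) \<le> ennreal (G0 * (sqrt B powr \<tau> * Ct + Ch) * S)"
      proof (rule suminf_le_const)
        fix J
        have a_le: "a j * (q ^ j - q ^ Suc j) \<le> G0 * (sqrt B powr \<tau> * ((2 powr (1 - \<tau>/2)) ^ j * T j powr (\<tau>/2)) +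
            (2 powr (1 - \<tau>/p)) ^ j * H j powr (\<tau>/p))" for j
        proof -
          have "a j = ((2 powr r) ^ Suc j * W j) powr \<tau> / q ^ Suc j"
            using q by (simp add: a_def powr_pow q\<theta> del: power_Suc)
          also have "((2 powr r) ^ Suc j * W j) powr \<tau> = (2 powr (r * \<tau>)) ^ Suc j * W j powr \<tau>"
            using W[of j] by (simp add: powr_mult powr_pow powr_powr del: power_Suc)
          finally have a_eq: "a j = (2 powr (r * \<tau>)) ^ Suc j * W j powr \<tau> / q ^ Suc j" .
          have "a j * (q ^ j - q ^ Suc j) \<le> a j * q ^ j"
            using q by (intro mult_left_mono) (auto simp: a_def)
          also have "\<dots> = G0 * ((2 powr (r * \<tau>)) ^ j * W j powr \<tau>)"
            using q by (simp add: a_eq G0_def)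
          \<comment> \<open>Subadditivity of the \<tau>-th power separates tail and head, so each
            meets its own Hardy inequality.\<close>
          also have "W j powr \<tau> \<le> (sqrt B * T j powr (1/2)) powr \<tau> + (q ^ j * H j powr (1/p)) powr \<tau>"
            unfolding W_def using sB q par by (intro powr_add_le) auto
          also have "(sqrt B * T j powr (1/2)) powr \<tau> = sqrt B powr \<tau> * T j powr (\<tau>/2)"
            using sB by (simp add: powr_mult powr_powr)
          also have "(q ^ j * H j powr (1/p)) powr \<tau> = (q powr \<tau>) ^ j * H j powr (\<tau>/p)"
            using q by (simp add: powr_mult powr_powr powr_pow)
          also have "(2 powr (r * \<tau>)) ^ j * (sqrt B powr \<tau> * T j powr (\<tau>/2) + (q powr \<tau>) ^ j * H j powr (\<tau>/p))
            = sqrt B powr \<tau> * ((2 powr (1 - \<tau>/2)) ^ j * T j powr (\<tau>/2)) +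
              (2 powr (r * \<tau>) * q powr \<tau>) ^ j * H j powr (\<tau>/p)"
            by (simp only: ex(4) mult.commute[of \<tau> r] power_mult_distrib distrib_left mult.assoc mult.left_commute)
          \<comment> \<open>The exponent is r \<tau> - \<rho> \<tau> = (1 - \<tau>/2) - (\<tau>/p -
            \<tau>/2), which is exactly the weight required by the Hardy inequality for
            heads.\<close>
          also have "2 powr (r * \<tau>) * q powr \<tau> = 2 powr (1 - \<tau>/p)"
            unfolding ex(4) q_def powr_powr powr_add[symmetric] by (simp add: algebra_simps)
          finally show ?thesis using G0 by (simp add: mult_left_mono)
        qed
        have "(\<Sum>j<J. a j * (q ^ j - q ^ Suc j)) \<le>
          G0 * (sqrt B powr \<tau> * (\<Sum>j<J. (2 powr (1 - \<tau>/2)) ^ j * T j powr (\<tau>/2)) +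
            (\<Sum>j<J. (2 powr (1 - \<tau>/p)) ^ j * H j powr (\<tau>/p)))"
          unfolding sum_distrib_left sum.distrib[symmetric] using sum_mono[OF a_le] by (simp add: sum_distrib_left)
        also have "\<dots> \<le> G0 * (sqrt B powr \<tau> * (Ct * S) + Ch * S)"
        proof (intro mult_left_mono add_mono)
          show "(\<Sum>j<J. (2 powr (1 - \<tau>/2)) ^ j * T j powr (\<tau>/2)) \<le> Ct * S"
            unfolding T_def Ct_def S_def psum_c using par by (intro hardy_tail_sum b) auto
          show "(\<Sum>j<J. (2 powr (1 - \<tau>/p)) ^ j * H j powr (\<tau>/p)) \<le> Ch * S"
            unfolding H_def S_def psum_c using b by (intro head) auto
        qed (use G0 in auto)
        also have "\<dots> = G0 * (sqrt B powr \<tau> * Ct + Ch) * S" by (simp add: algebra_simps)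
        finally have "ennreal (\<Sum>j<J. a j * (q ^ j - q ^ Suc j)) \<le> ennreal (G0 * (sqrt B powr \<tau> * Ct + Ch) * S)"
          by (rule ennreal_leI)
        moreover have "0 \<le> a j * (q ^ j - q ^ Suc j)" for j
          using q by (intro mult_nonneg_nonneg) (auto simp: a_def mult_left_le_one_le)
        ultimately show "(\<Sum>j<J. ennreal (a j * (q ^ j - q ^ Suc j))) \<le> ennreal (G0 * (sqrt B powr \<tau> * Ct + Ch) * S)"
          by (simp add: sum_ennreal del: power_Suc)
      qed simp
      also have "ennreal (G0 * (sqrt B powr \<tau> * Ct + Ch) * S) + ennreal (sqrt B powr \<tau> / (\<theta> * \<tau>) * S) = ennreal (C * S)"
        using S G0 Ct Ch par unfolding C_def distrib_right[of _ _ S]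
        by (intro ennreal_plus[symmetric] mult_nonneg_nonneg add_nonneg_nonneg) auto
      finally have "interp_norm \<Phi> p \<theta> \<tau> f \<le> epowr (ennreal (C * S)) (1/\<tau>)"
        unfolding interp_norm_def F_def using par by (intro epowr_mono) (auto intro: add_mono order_trans)
      also have "\<dots> = ennreal ((C * S) powr (1/\<tau>))"
        using C S by (intro epowr_ennreal) auto
      also have "\<dots> = ennreal (C powr (1/\<tau>)) * ennreal (lnorm \<tau> c)"
        using C S by (simp add: powr_mult ennreal_mult S_def lnorm_psum)
      finally show "interp_norm \<Phi> p \<theta> \<tau> f \<le> ennreal (C powr (1/\<tau>)) * ennreal (lnorm \<tau> c)" .
    qed
  qed
qed

section \<open>Closing the cycle of inequalities\<close>

lemma ennreal_bound_finite:
  fixes x y :: ennreal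
  assumes "x \<le> ennreal C * y" "y < \<infinity>"
  shows "x < \<infinity>"
proof (rule order.strict_trans1[OF assms(1)])
  show "ennreal C * y < \<infinity>" using assms(2) by (simp add: ennreal_mult_less_top)
qed

lemma ennreal_inverse_bound:
  fixes x y :: ennreal
  assumes "x \<le> ennreal C * y" "0 < C"
  shows "ennreal (1 / C) * x \<le> y"
proof -
  have "ennreal (1 / C) * x \<le> ennreal (1 / C) * (ennreal C * y)"
    by (rule mult_left_mono[OF assms(1)]) simp
  also have "\<dots> = y"
    using assms(2) by (simp add: mult.assoc[symmetric] ennreal_mult[symmetric])
  finally show ?thesis .
qed

theorem theorem1p4:
  fixes A B \<delta> \<kappa> :: real
  assumes "0 < A" and "A \<le> B" and "\<delta> < 1" and "0 < \<kappa>" and "\<kappa> < 1"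
  shows
    "(\<forall>(m::nat) (N::nat) (\<Phi>::real mat).
        \<Phi> \<in> carrier_mat m N \<and> frame_bounds \<Phi> A B \<and> LRIP \<Phi> (\<kappa> * real N) \<delta> \<longrightarrow>
        (\<forall>\<tau>::real. 0 < \<tau> \<and> \<tau> \<le> 2 \<longrightarrow>
          (\<forall>k::nat. 1 \<le> k \<longrightarrow> (\<forall>f\<in>sparse_set \<Phi> k.
             sparsity_norm \<Phi> \<tau> f \<le>
               ennreal (max ((1 - \<delta>) powr (- 1 / 2)) (A powr (- 1 / 2) * \<kappa> powr (1 / 2 - 1 / \<tau>))
                        * real k powr (1 / \<tau> - 1 / 2) * enorm2 f)))))
     \<and>
     (\<forall>(\<tau>::real) (\<theta>::real) (r::real) (p::real).
        0 < \<tau> \<and> \<tau> \<le> 1 \<and> 0 < \<theta> \<and> \<theta> < 1 \<and> r = 1 / \<tau> - 1 / 2 \<and>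
        0 < p \<and> 1 / \<tau> = \<theta> / p + (1 - \<theta>) / 2 \<longrightarrow>
        (\<exists>c\<^sub>1>0. \<exists>C\<^sub>1>0. \<exists>c\<^sub>2>0. \<exists>C\<^sub>2>0.
          \<forall>(m::nat) (N::nat) (\<Phi>::real mat).
            \<Phi> \<in> carrier_mat m N \<and> frame_bounds \<Phi> A B \<and> LRIP \<Phi> (\<kappa> * real N) \<delta> \<longrightarrow>
            approx_space \<Phi> r \<tau> = sparsity_space \<Phi> \<tau> \<and>
            sparsity_space \<Phi> \<tau> = interp_space \<Phi> p \<theta> \<tau> \<and>
            norms_equiv_on (sparsity_space \<Phi> \<tau>) c\<^sub>1 C\<^sub>1 (sparsity_norm \<Phi> \<tau>) (approx_norm \<Phi> r \<tau>) \<and>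
            norms_equiv_on (sparsity_space \<Phi> \<tau>) c\<^sub>2 C\<^sub>2 (sparsity_norm \<Phi> \<tau>) (interp_norm \<Phi> p \<theta> \<tau>)))"
proof (intro conjI allI impI ballI)
  fix m N :: nat and \<Phi> :: "real mat" and \<tau> :: real and k :: nat and f
  assume \<Phi>: "\<Phi> \<in> carrier_mat m N \<and> frame_bounds \<Phi> A B \<and> LRIP \<Phi> (\<kappa> * real N) \<delta>"
    and \<tau>: "0 < \<tau> \<and> \<tau> \<le> 2" and k: "1 \<le> k" and f: "f \<in> sparse_set \<Phi> k"
  interpret lrip_frame m N \<Phi> A B \<delta> \<kappa>
    using \<Phi> assms by unfold_locales auto
  obtain c where c: "c \<in> carrier_vec N" "\<Phi> *\<^sub>v c = f"
    and le: "lnorm \<tau> c \<le> bernstein_const A \<delta> \<kappa> \<tau> * real k powr (1/\<tau> - 1/2) * enorm2 f"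
    using bernstein_coefficients[OF f k] \<tau> by blast
  have "sparsity_norm \<Phi> \<tau> f \<le> ennreal (lnorm \<tau> c)"
    by (rule sparsity_norm_le) (use c in simp_all)
  also have "\<dots> \<le> ennreal (bernstein_const A \<delta> \<kappa> \<tau> * real k powr (1/\<tau> - 1/2) * enorm2 f)"
    using le by (rule ennreal_leI)
  finally show "sparsity_norm \<Phi> \<tau> f \<le>
      ennreal (max ((1 - \<delta>) powr (- 1 / 2)) (A powr (- 1 / 2) * \<kappa> powr (1 / 2 - 1 / \<tau>))
        * real k powr (1 / \<tau> - 1 / 2) * enorm2 f)"
    by (simp only: bernstein_const_def)
next
  fix \<tau> \<theta> r p :: real
  assume "0 < \<tau> \<and> \<tau> \<le> 1 \<and> 0 < \<theta> \<and> \<theta> < 1 \<and> r = 1 / \<tau> - 1 / 2 \<and>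
    0 < p \<and> 1 / \<tau> = \<theta> / p + (1 - \<theta>) / 2"
  then have par: "0 < \<tau>" "\<tau> \<le> 1" "0 < \<theta>" "\<theta> < 1" "r = 1/\<tau> - 1/2" "0 < p" "1/\<tau> = \<theta>/p + (1 - \<theta>)/2"
    by auto
  obtain K\<^sub>1 where K\<^sub>1: "0 < K\<^sub>1" "\<forall>m N \<Phi>. lrip_frame m N \<Phi> A B \<delta> \<kappa> \<longrightarrow>
      (\<forall>f\<in>carrier_vec m. sparsity_norm \<Phi> \<tau> f \<le> ennreal K\<^sub>1 * approx_norm \<Phi> r \<tau> f)"
    using sparsity_le_approx[OF par(1,2,5)] by blast
  obtain K\<^sub>2 where K\<^sub>2: "0 < K\<^sub>2" "\<forall>m N \<Phi>. lrip_frame m N \<Phi> A B \<delta> \<kappa> \<longrightarrow>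
      (\<forall>f\<in>carrier_vec m. approx_norm \<Phi> r \<tau> f \<le> ennreal K\<^sub>2 * interp_norm \<Phi> p \<theta> \<tau> f)"
    using approx_le_interp[OF par] by blast
  obtain K\<^sub>3 where K\<^sub>3: "0 < K\<^sub>3" "\<forall>m N \<Phi>. lrip_frame m N \<Phi> A B \<delta> \<kappa> \<longrightarrow>
      (\<forall>f\<in>carrier_vec m. interp_norm \<Phi> p \<theta> \<tau> f \<le> ennreal K\<^sub>3 * sparsity_norm \<Phi> \<tau> f)"
    using interp_le_sparsity[OF par assms(1,2)] by blast
  \<comment> \<open>Going round the cycle, the upper constants become
    \<open>K\<^sub>2 * K\<^sub>3\<close> and \<open>K\<^sub>3\<close>, the lower ones the
    reciprocals of \<open>K\<^sub>1\<close> and \<open>K\<^sub>1 * K\<^sub>2\<close>. All are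
    obtained before \<open>m\<close>, \<open>N\<close> and \<open>\<Phi>\<close> are fixed.\<close>
  have pos: "0 < 1 / K\<^sub>1" "0 < K\<^sub>2 * K\<^sub>3" "0 < 1 / (K\<^sub>1 * K\<^sub>2)" using K\<^sub>1(1) K\<^sub>2(1) K\<^sub>3(1) by auto
  have main: "approx_space \<Phi> r \<tau> = sparsity_space \<Phi> \<tau> \<and>
      sparsity_space \<Phi> \<tau> = interp_space \<Phi> p \<theta> \<tau> \<and>
      norms_equiv_on (sparsity_space \<Phi> \<tau>) (1 / K\<^sub>1) (K\<^sub>2 * K\<^sub>3) (sparsity_norm \<Phi> \<tau>) (approx_norm \<Phi> r \<tau>) \<and>
      norms_equiv_on (sparsity_space \<Phi> \<tau>) (1 / (K\<^sub>1 * K\<^sub>2)) K\<^sub>3 (sparsity_norm \<Phi> \<tau>) (interp_norm \<Phi> p \<theta> \<tau>)"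
    if \<Phi>: "\<Phi> \<in> carrier_mat m N \<and> frame_bounds \<Phi> A B \<and> LRIP \<Phi> (\<kappa> * real N) \<delta>" for m N \<Phi>
  proof -
    interpret lrip_frame m N \<Phi> A B \<delta> \<kappa>
      using \<Phi> assms by unfold_locales auto
    have frame: "lrip_frame m N \<Phi> A B \<delta> \<kappa>" ..
    have sa: "sparsity_norm \<Phi> \<tau> f \<le> ennreal K\<^sub>1 * approx_norm \<Phi> r \<tau> f"
      and ai: "approx_norm \<Phi> r \<tau> f \<le> ennreal K\<^sub>2 * interp_norm \<Phi> p \<theta> \<tau> f"
      and intp: "interp_norm \<Phi> p \<theta> \<tau> f \<le> ennreal K\<^sub>3 * sparsity_norm \<Phi> \<tau> f"
      if "f \<in> carrier_vec m" for f
      using K\<^sub>1(2) K\<^sub>2(2) K\<^sub>3(2) frame that by blast+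
    have app: "approx_norm \<Phi> r \<tau> f \<le> ennreal (K\<^sub>2 * K\<^sub>3) * sparsity_norm \<Phi> \<tau> f" if "f \<in> carrier_vec m" for f
      using order_trans[OF ai[OF that] mult_left_mono[OF intp[OF that]]] K\<^sub>2(1) K\<^sub>3(1)
      by (simp add: ennreal_mult mult.assoc)
    have si: "sparsity_norm \<Phi> \<tau> f \<le> ennreal (K\<^sub>1 * K\<^sub>2) * interp_norm \<Phi> p \<theta> \<tau> f" if "f \<in> carrier_vec m" for f
      using order_trans[OF sa[OF that] mult_left_mono[OF ai[OF that]]] K\<^sub>1(1) K\<^sub>2(1)
      by (simp add: ennreal_mult mult.assoc)
    \<comment> \<open>Finiteness of this one quasi-norm on all of \<open>carrier_vec m\<close> is
      carried by the upper bounds to the other two, so the three sets coincide.\<close>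
    have fin: "sparsity_norm \<Phi> \<tau> f < \<infinity>" if "f \<in> carrier_vec m" for f
      using sparsity_space_eq[of \<tau>] that unfolding sparsity_space_def by auto
    have "approx_space \<Phi> r \<tau> = carrier_vec m"
      unfolding approx_space_def dims using ennreal_bound_finite[OF app fin] by blast
    moreover have "interp_space \<Phi> p \<theta> \<tau> = carrier_vec m"
      unfolding interp_space_def dims using ennreal_bound_finite[OF intp fin] by blast
    moreover have "norms_equiv_on (carrier_vec m) (1 / K\<^sub>1) (K\<^sub>2 * K\<^sub>3) (sparsity_norm \<Phi> \<tau>) (approx_norm \<Phi> r \<tau>)"
      unfolding norms_equiv_on_def using ennreal_inverse_bound[OF sa K\<^sub>1(1)] app by blast
    moreover have "norms_equiv_on (carrier_vec m) (1 / (K\<^sub>1 * K\<^sub>2)) K\<^sub>3 (sparsity_norm \<Phi> \<tau>) (interp_norm \<Phi> p \<theta> \<tau>)"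
      unfolding norms_equiv_on_def using ennreal_inverse_bound[OF si mult_pos_pos[OF K\<^sub>1(1) K\<^sub>2(1)]] intp by blast
    ultimately show ?thesis unfolding sparsity_space_eq by simp
  qed
  show "\<exists>c\<^sub>1>0. \<exists>C\<^sub>1>0. \<exists>c\<^sub>2>0. \<exists>C\<^sub>2>0.
      \<forall>(m::nat) (N::nat) (\<Phi>::real mat).
        \<Phi> \<in> carrier_mat m N \<and> frame_bounds \<Phi> A B \<and> LRIP \<Phi> (\<kappa> * real N) \<delta> \<longrightarrow>
        approx_space \<Phi> r \<tau> = sparsity_space \<Phi> \<tau> \<and>
        sparsity_space \<Phi> \<tau> = interp_space \<Phi> p \<theta> \<tau> \<and>
        norms_equiv_on (sparsity_space \<Phi> \<tau>) c\<^sub>1 C\<^sub>1 (sparsity_norm \<Phi> \<tau>) (approx_norm \<Phi> r \<tau>) \<and>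
        norms_equiv_on (sparsity_space \<Phi> \<tau>) c\<^sub>2 C\<^sub>2 (sparsity_norm \<Phi> \<tau>) (interp_norm \<Phi> p \<theta> \<tau>)"
    by (rule exI[of _ "1 / K\<^sub>1"], rule conjI[OF pos(1)],
        rule exI[of _ "K\<^sub>2 * K\<^sub>3"], rule conjI[OF pos(2)],
        rule exI[of _ "1 / (K\<^sub>1 * K\<^sub>2)"], rule conjI[OF pos(3)],
        rule exI[of _ "K\<^sub>3"], rule conjI[OF K\<^sub>3(1)]) (intro allI impI main)
qed

end
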